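(* Let $q$ be a prime power and let $U\le\mathrm{GL}(2,\mathbb F_q)$ be the subgroup of unipotent matrices. Then $(\mathrm{GL}(2,\mathbb F_q),U,\chi)$ is a multiplicity-free triple for every non-trivial additive character $\chi$ of $U\cong\mathbb F_q$, but $(\mathrm{GL}(2,\mathbb F_q),U)$ is not a Gelfand pair; that is, $(\mathrm{GL}(2,\mathbb F_q),U,\chi_0)$ is not multiplicity-free if $\chi_0$ is the trivial character.
   Context: $\mathbb F_q$ is the field with $q=p^n$ elements, $p$ a prime and $n$ a positive integer. $U=\left\{\begin{pmatrix}1&b\\0&1\end{pmatrix}:b\in\mathbb F_q\right\}\cong(\mathbb F_q,+)$. For a finite group $G$, a subgroup $K\le G$ and an irreducible $K$-representation $\theta$, $(G,K,\theta)$ is a multiplicity-free triple if $\mathrm{Ind}_K^G\theta$ contains every irreducible $G$-representation at most once; $(G,K)$ is a Gelfand pair if $(G,K,\theta)$ is multiplicity-free for $\theta$ the trivial representation of $K$.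
   Formalization: The claim that the pair is not Gelfand (trivial character) is stated only for q ≠ 2, since for q = 2 the group is S_3, U has order 2, and the induced trivial representation is multiplicity-free; the claim for non-trivial characters is stated for all q. *)

theory Defs
  imports
    "HOL-Analysis.Determinants"
    "HOL-Algebra.Coset"
    "HOL-Library.Function_Algebras"
    "HOL-Computational_Algebra.Primes"
begin

section \<open>Complex vector spaces\<close>

class complex_vector = ab_group_add +
  fixes scaleC :: "complex \<Rightarrow> 'a \<Rightarrow> 'a" (infixr "*\<^sub>C" 75)
  assumes scaleC_right_distrib: "a *\<^sub>C (x + y) = a *\<^sub>C x + a *\<^sub>C y"
    and scaleC_left_distrib: "(a + b) *\<^sub>C x = a *\<^sub>C x + b *\<^sub>C x"
    and scaleC_scaleC: "a *\<^sub>C b *\<^sub>C x = (a * b) *\<^sub>C x"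
    and scaleC_one: "1 *\<^sub>C x = x"

global_interpretation complex_vector: vector_space "scaleC :: complex \<Rightarrow> 'a \<Rightarrow> 'a::complex_vector"
  by unfold_locales (rule scaleC_right_distrib scaleC_left_distrib scaleC_scaleC scaleC_one)+

instantiation complex :: complex_vector
begin
definition scaleC_complex_def: "a *\<^sub>C (z::complex) = a * z"
instance by standard (simp_all add: scaleC_complex_def algebra_simps)
end

instantiation "fun" :: (type, complex_vector) complex_vector
begin
definition scaleC_fun_def: "a *\<^sub>C f = (\<lambda>x. a *\<^sub>C f x)"
instance
  by standard
    (simp_all add: scaleC_fun_def fun_eq_iff scaleC_right_distrib scaleC_left_distrib
      scaleC_scaleC scaleC_one)
end


section \<open>Complex representations\<close>

text \<open>The underlying space is a linear subspace of an ambient complex vector space, and only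
  the values of the action on that subspace matter.\<close>

record ('g, 'v) rep =
  rep_space :: "'v set"
  rep_act :: "'g \<Rightarrow> 'v \<Rightarrow> 'v"

definition linear_between ::
    "'v::complex_vector set \<Rightarrow> 'w::complex_vector set \<Rightarrow> ('v \<Rightarrow> 'w) \<Rightarrow> bool" where
  "linear_between V W T \<longleftrightarrow> T \<in> V \<rightarrow> W \<and>
     (\<forall>x\<in>V. \<forall>y\<in>V. T (x + y) = T x + T y) \<and> (\<forall>c. \<forall>x\<in>V. T (c *\<^sub>C x) = c *\<^sub>C T x)"

definition group_rep ::
    "('g, 'm) monoid_scheme \<Rightarrow> ('g, 'v::complex_vector) rep \<Rightarrow> bool" where
  "group_rep G \<rho> \<longleftrightarrow>
     complex_vector.subspace (rep_space \<rho>) \<and>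
     (\<forall>g\<in>carrier G. linear_between (rep_space \<rho>) (rep_space \<rho>) (rep_act \<rho> g)) \<and>
     (\<forall>v\<in>rep_space \<rho>. rep_act \<rho> \<one>\<^bsub>G\<^esub> v = v) \<and>
     (\<forall>g\<in>carrier G. \<forall>h\<in>carrier G. \<forall>v\<in>rep_space \<rho>.
        rep_act \<rho> (g \<otimes>\<^bsub>G\<^esub> h) v = rep_act \<rho> g (rep_act \<rho> h v))"

definition invariant_subspace ::
    "('g, 'm) monoid_scheme \<Rightarrow> ('g, 'v::complex_vector) rep \<Rightarrow> 'v set \<Rightarrow> bool" where
  "invariant_subspace G \<rho> W \<longleftrightarrow>
     complex_vector.subspace W \<and> W \<subseteq> rep_space \<rho> \<and> (\<forall>g\<in>carrier G. rep_act \<rho> g ` W \<subseteq> W)"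

definition irreducible_rep ::
    "('g, 'm) monoid_scheme \<Rightarrow> ('g, 'v::complex_vector) rep \<Rightarrow> bool" where
  "irreducible_rep G \<rho> \<longleftrightarrow>
     group_rep G \<rho> \<and> rep_space \<rho> \<noteq> {0} \<and>
     (\<forall>W. invariant_subspace G \<rho> W \<longrightarrow> W = {0} \<or> W = rep_space \<rho>)"

definition intertwiner ::
    "('g, 'm) monoid_scheme \<Rightarrow> ('g, 'v::complex_vector) rep \<Rightarrow> ('g, 'w::complex_vector) rep \<Rightarrow>
      ('v \<Rightarrow> 'w) \<Rightarrow> bool" where
  "intertwiner G \<rho> \<sigma> T \<longleftrightarrow>
     linear_between (rep_space \<rho>) (rep_space \<sigma>) T \<and>
     (\<forall>g\<in>carrier G. \<forall>v\<in>rep_space \<rho>. T (rep_act \<rho> g v) = rep_act \<sigma> g (T v))"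

definition contains_rep ::
    "('g, 'm) monoid_scheme \<Rightarrow> ('g, 'v::complex_vector) rep \<Rightarrow> ('g, 'w::complex_vector) rep \<Rightarrow>
      bool" where
  "contains_rep G \<rho> \<sigma> \<longleftrightarrow> (\<exists>T. intertwiner G \<sigma> \<rho> T \<and> inj_on T (rep_space \<sigma>))"

text \<open>The direct sum of \<open>m\<close> copies of \<open>\<sigma>\<close>, realised on finitely supported sequences.\<close>

definition rep_copies :: "nat \<Rightarrow> ('g, 'v::complex_vector) rep \<Rightarrow> ('g, nat \<Rightarrow> 'v) rep" where
  "rep_copies m \<sigma> = \<lparr>
     rep_space = {f. (\<forall>i<m. f i \<in> rep_space \<sigma>) \<and> (\<forall>i\<ge>m. f i = 0)},
     rep_act = (\<lambda>g f i. if i < m then rep_act \<sigma> g (f i) else 0)\<rparr>"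

text \<open>An irreducible representation of a finite group is finite-dimensional, hence isomorphic
  to one whose space is a subspace of \<^typ>\<open>nat \<Rightarrow> complex\<close>.  So for finite \<open>G\<close> the quantifier
  over \<open>\<sigma>\<close> below reaches every irreducible representation up to isomorphism.\<close>

definition multiplicity_free ::
    "('g, 'm) monoid_scheme \<Rightarrow> ('g, 'v::complex_vector) rep \<Rightarrow> bool" where
  "multiplicity_free G \<rho> \<longleftrightarrow>
     (\<forall>\<sigma> :: ('g, nat \<Rightarrow> complex) rep. irreducible_rep G \<sigma> \<longrightarrow>
        (\<forall>m. contains_rep G \<rho> (rep_copies m \<sigma>) \<longrightarrow> m \<le> 1))"

text \<open>Functions on the carrier are extended by \<open>0\<close> to the whole type.\<close>

definition induced_rep ::
    "('g, 'm) monoid_scheme \<Rightarrow> 'g set \<Rightarrow> ('g, 'v::complex_vector) rep \<Rightarrow> ('g, 'g \<Rightarrow> 'v) rep" where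
  "induced_rep G K \<theta> = \<lparr>
     rep_space = {f. (\<forall>x\<in>carrier G. f x \<in> rep_space \<theta>) \<and> (\<forall>x. x \<notin> carrier G \<longrightarrow> f x = 0) \<and>
       (\<forall>x\<in>carrier G. \<forall>k\<in>K. f (x \<otimes>\<^bsub>G\<^esub> k) = rep_act \<theta> (inv\<^bsub>G\<^esub> k) (f x))},
     rep_act = (\<lambda>g f x. if x \<in> carrier G then f (inv\<^bsub>G\<^esub> g \<otimes>\<^bsub>G\<^esub> x) else 0)\<rparr>"

lemma group_rep_induced_rep:
  assumes "group G" "subgroup K G" "group_rep (G\<lparr>carrier := K\<rparr>) \<theta>"
  shows "group_rep G (induced_rep G K \<theta>)"
proof -
  interpret group G by fact
  interpret K: subgroup K G by fact
  have \<theta>: "complex_vector.subspace (rep_space \<theta>)"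
    "\<And>k v. k \<in> K \<Longrightarrow> v \<in> rep_space \<theta> \<Longrightarrow> rep_act \<theta> k v \<in> rep_space \<theta>"
    "\<And>k v w. k \<in> K \<Longrightarrow> v \<in> rep_space \<theta> \<Longrightarrow> w \<in> rep_space \<theta> \<Longrightarrow>
      rep_act \<theta> k (v + w) = rep_act \<theta> k v + rep_act \<theta> k w"
    "\<And>k v c. k \<in> K \<Longrightarrow> v \<in> rep_space \<theta> \<Longrightarrow> rep_act \<theta> k (c *\<^sub>C v) = c *\<^sub>C rep_act \<theta> k v"
    using assms(3) by (auto simp: group_rep_def linear_between_def)
  have zero: "rep_act \<theta> k 0 = 0" if "k \<in> K" for k
    using \<theta>(4)[OF that complex_vector.subspace_0[OF \<theta>(1)], of 0] by simp
  let ?V = "rep_space (induced_rep G K \<theta>)"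
  note defs = induced_rep_def scaleC_fun_def fun_eq_iff
  have sub: "complex_vector.subspace ?V"
    by (rule complex_vector.subspaceI)
      (auto simp: defs \<theta> zero complex_vector.subspace_0[OF \<theta>(1)]
        complex_vector.subspace_add[OF \<theta>(1)] complex_vector.subspace_scale[OF \<theta>(1)])
  have closed: "rep_act (induced_rep G K \<theta>) g f \<in> ?V" if "g \<in> carrier G" "f \<in> ?V" for g f
    using that by (auto simp: defs m_assoc[symmetric])
  have one: "rep_act (induced_rep G K \<theta>) \<one>\<^bsub>G\<^esub> f = f" if "f \<in> ?V" for f
    using that by (auto simp: defs)
  have mult: "rep_act (induced_rep G K \<theta>) (g \<otimes>\<^bsub>G\<^esub> h) f =
      rep_act (induced_rep G K \<theta>) g (rep_act (induced_rep G K \<theta>) h f)"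
    if "g \<in> carrier G" "h \<in> carrier G" for g h f
    using that by (auto simp: defs inv_mult_group m_assoc)
  show ?thesis
    unfolding group_rep_def linear_between_def
    using sub closed one mult
    by (auto simp: induced_rep_def scaleC_fun_def fun_eq_iff)
qed

text \<open>The following two notions are meant for a finite group \<open>G\<close>, a subgroup \<open>K\<close> and an
  irreducible representation \<open>\<theta>\<close> of \<open>K\<close>; these conditions are not repeated in the definitions,
  so that the negations carry content only about the induced representation.\<close>

definition multiplicity_free_triple ::
    "('g, 'm) monoid_scheme \<Rightarrow> 'g set \<Rightarrow> ('g, 'v::complex_vector) rep \<Rightarrow> bool" where
  "multiplicity_free_triple G K \<theta> \<longleftrightarrow> multiplicity_free G (induced_rep G K \<theta>)"

definition trivial_rep :: "('g, complex) rep" where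
  "trivial_rep = \<lparr>rep_space = UNIV, rep_act = (\<lambda>g z. z)\<rparr>"

definition gelfand_pair :: "('g, 'm) monoid_scheme \<Rightarrow> 'g set \<Rightarrow> bool" where
  "gelfand_pair G K \<longleftrightarrow> multiplicity_free_triple G K (trivial_rep :: ('g, complex) rep)"


section \<open>The general linear group, its unipotent subgroup and additive characters\<close>

definition GL2 :: "('a::field ^ 2 ^ 2) monoid" where
  "GL2 = \<lparr>carrier = {A. invertible A}, mult = (**), one = mat 1\<rparr>"

definition unipotent :: "'a::field \<Rightarrow> 'a ^ 2 ^ 2" where
  "unipotent b = vector [vector [1, b], vector [0, 1]]"

definition U :: "('a::field ^ 2 ^ 2) set" where
  "U = range unipotent"

text \<open>Over the field with two elements, \<open>U\<close> is a subgroup of order 2 in the symmetric group of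
  degree 3, and inducing its trivial representation gives the permutation representation on three
  points, which is multiplicity-free.  So the pair is Gelfand in that one case, and the claim that
  it is not Gelfand needs \<open>q \<noteq> 2\<close>.\<close>

definition additive_character :: "('a::field \<Rightarrow> complex) \<Rightarrow> bool" where
  "additive_character \<psi> \<longleftrightarrow> (\<forall>x. cmod (\<psi> x) = 1) \<and> (\<forall>x y. \<psi> (x + y) = \<psi> x * \<psi> y)"

text \<open>The one-dimensional representation of \<open>U\<close> given by \<open>\<psi>\<close> through the isomorphism
  \<open>unipotent b \<mapsto> b\<close>, whose value is the upper right entry.\<close>

definition char_rep :: "('a::field \<Rightarrow> complex) \<Rightarrow> ('a ^ 2 ^ 2, complex) rep" where
  "char_rep \<psi> = \<lparr>rep_space = UNIV, rep_act = (\<lambda>u z. \<psi> (u $ 1 $ 2) * z)\<rparr>"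

lemma group_GL2: "group (GL2 :: ('a::field ^ 2 ^ 2) monoid)"
proof (rule groupI)
  fix A :: "'a ^ 2 ^ 2" assume "A \<in> carrier GL2"
  then obtain B where "A ** B = mat 1" "B ** A = mat 1"
    by (auto simp: GL2_def invertible_def)
  then show "\<exists>B\<in>carrier GL2. B \<otimes>\<^bsub>GL2\<^esub> A = \<one>\<^bsub>GL2\<^esub>"
    by (auto simp: GL2_def invertible_def)
qed (auto simp: GL2_def invertible_mult matrix_mul_assoc invertible_def[of "mat 1"])

lemma finite_GL2: "finite (carrier (GL2 :: ('a::{field, finite} ^ 2 ^ 2) monoid))"
  by simp

lemma unipotent_entry: "unipotent b $ 1 $ 2 = b"
  by (simp add: unipotent_def)

lemma unipotent_0: "unipotent 0 = mat 1"
  by (simp add: unipotent_def vec_eq_iff forall_2 mat_def)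

lemma unipotent_mult: "unipotent a ** unipotent b = unipotent (a + b)"
  by (simp add: unipotent_def vec_eq_iff forall_2 matrix_matrix_mult_def sum_2 add.commute)

lemma unipotent_in_GL2: "unipotent b \<in> carrier GL2"
  unfolding GL2_def invertible_def
  by (auto simp: unipotent_mult unipotent_0 intro!: exI[of _ "unipotent (- b)"])

lemma subgroup_U: "subgroup U (GL2 :: ('a::field ^ 2 ^ 2) monoid)"
proof -
  interpret group "GL2 :: ('a ^ 2 ^ 2) monoid" by (rule group_GL2)
  have inv: "inv\<^bsub>GL2\<^esub> (unipotent b) = unipotent (- b)" for b :: 'a
    by (rule inv_equality)
      (simp_all add: unipotent_in_GL2, simp add: GL2_def unipotent_mult unipotent_0)
  show ?thesis
  proof (rule subgroupI)
    fix A B :: "'a ^ 2 ^ 2" assume "A \<in> U" "B \<in> U"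
    then show "A \<otimes>\<^bsub>GL2\<^esub> B \<in> U"
      by (auto simp: U_def GL2_def unipotent_mult)
  qed (auto simp: U_def unipotent_in_GL2 inv)
qed

lemma irreducible_one_dim:
  fixes \<rho> :: "('g, complex) rep"
  assumes "group_rep G \<rho>" "rep_space \<rho> = UNIV"
  shows "irreducible_rep G \<rho>"
proof -
  have "W = {0} \<or> W = UNIV" if W: "complex_vector.subspace W" for W :: "complex set"
  proof (rule disjCI)
    assume "W \<noteq> UNIV"
    have "z = 0" if "z \<in> W" for z
    proof (rule ccontr)
      assume "z \<noteq> 0"
      then have "w \<in> W" for w
        using complex_vector.subspace_scale[OF W that, of "w / z"]
        by (simp add: scaleC_complex_def)
      with \<open>W \<noteq> UNIV\<close> show False by blast
    qed
    with complex_vector.subspace_0[OF W] show "W = {0}" by blast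
  qed
  moreover have "(UNIV :: complex set) \<noteq> {0}"
    by (metis UNIV_I singletonD zero_neq_one)
  ultimately show ?thesis
    using assms by (auto simp: irreducible_rep_def invariant_subspace_def)
qed

lemma irreducible_char_rep:
  fixes \<psi> :: "'a::field \<Rightarrow> complex"
  assumes "additive_character \<psi>"
  shows "irreducible_rep (GL2\<lparr>carrier := U\<rparr>) (char_rep \<psi>)"
proof (rule irreducible_one_dim)
  have "\<psi> (0 + 0) = \<psi> 0 * \<psi> 0" "cmod (\<psi> 0) = 1"
    using assms unfolding additive_character_def by blast+
  then have "\<psi> 0 = 1" by auto
  moreover have "\<psi> (x + y) = \<psi> x * \<psi> y" for x y
    using assms unfolding additive_character_def by blast
  moreover have "(mat 1 :: 'a ^ 2 ^ 2) $ 1 $ 2 = 0"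
    by (simp add: mat_def)
  ultimately show "group_rep (GL2\<lparr>carrier := U\<rparr>) (char_rep \<psi>)"
    by (auto simp: group_rep_def linear_between_def char_rep_def scaleC_complex_def U_def
        GL2_def unipotent_mult unipotent_entry algebra_simps)
qed (simp add: char_rep_def)

lemma char_rep_trivial: "char_rep (\<lambda>_. 1) = trivial_rep"
  by (simp add: char_rep_def trivial_rep_def)

end

theory Submission
  imports Defs "HOL-Computational_Algebra.Fundamental_Theorem_Algebra"
begin

text \<open>Let \<open>E = (\<Sum>b. \<psi> (- b) u\<^sub>b)\<close> be the (unnormalised) projection onto the \<open>\<psi>\<close>-eigenspace of
  \<open>U\<close>. By Frobenius reciprocity the multiplicity of an irreducible \<open>\<sigma>\<close> in the representation induced
  from \<open>\<psi>\<close> is the dimension of \<open>E \<sigma>\<close>, on which the operators \<open>E g E\<close> act irreducibly. For non-trivial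
  \<open>\<psi>\<close> the Bruhat decomposition shows \<open>E g E = E g' E\<close>, where the anti-involution \<open>g \<mapsto> g'\<close> exchanges
  the diagonal entries of \<open>g\<close>; hence these operators commute and \<open>E \<sigma>\<close> is at most a line (the
  Gelfand--Kazhdan argument).

  For the trivial character, the endomorphisms \<open>R\<^sub>t\<close> (right translation by a diagonal matrix \<open>t\<close>) and
  \<open>M f x = (\<Sum>b. f (x u\<^sub>b w))\<close> of the functions on \<open>G / U\<close> satisfy \<open>M R\<^sub>t = R\<^sub>s M\<close> with \<open>s = w t w\<close>, so they
  do not commute if \<open>t \<noteq> s\<close>, whereas multiplicity one would force all endomorphisms to commute.\<close>

section \<open>Eigenvectors\<close>

lemma scaleC_fun_apply: "(c *\<^sub>C f) x = c *\<^sub>C f x"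
  by (simp add: scaleC_fun_def)

lemma sum_fun_apply: "sum f I x = (\<Sum>i\<in>I. f i x)"
  for f :: "'i \<Rightarrow> 'x \<Rightarrow> 'b::comm_monoid_add"
  by (induction I rule: infinite_finite_induct) simp_all

lemma linear_betweenD:
  assumes "linear_between V W T"
  shows "x \<in> V \<Longrightarrow> T x \<in> W"
    and "x \<in> V \<Longrightarrow> y \<in> V \<Longrightarrow> T (x + y) = T x + T y"
    and "x \<in> V \<Longrightarrow> T (c *\<^sub>C x) = c *\<^sub>C T x"
  using assms by (auto simp: linear_between_def)

lemma linear_between_0:
  assumes "linear_between V W T" "complex_vector.subspace V"
  shows "T 0 = 0"
  using linear_betweenD(3)[OF assms(1) complex_vector.subspace_0[OF assms(2)], of 0] by simp

lemma linear_between_sum: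
  assumes "linear_between V W T" "complex_vector.subspace V" "\<And>i. i \<in> I \<Longrightarrow> f i \<in> V"
  shows "T (sum f I) = (\<Sum>i\<in>I. T (f i))"
  using assms(3)
proof (induction I rule: infinite_finite_induct)
  case (insert i I)
  then show ?case
    by (simp add: linear_betweenD(2)[OF assms(1)] complex_vector.subspace_sum[OF assms(2)])
qed (simp_all add: linear_between_0[OF assms(1,2)])

text \<open>The vector \<open>p(T) v\<close>, evaluated by Horner's scheme. Fixing \<open>v\<close>
  keeps every intermediate value inside the subspace on which \<open>T\<close> is linear.\<close>

definition poly_apply :: "('v::complex_vector \<Rightarrow> 'v) \<Rightarrow> complex poly \<Rightarrow> 'v \<Rightarrow> 'v" where
  "poly_apply T p v = fold_coeffs (\<lambda>a w. a *\<^sub>C v + T w) p 0"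

context
  fixes V :: "'v::complex_vector set" and T :: "'v \<Rightarrow> 'v" and v :: 'v
  assumes lin: "linear_between V V T" and sub: "complex_vector.subspace V" and v: "v \<in> V"
begin

lemma poly_apply_0: "poly_apply T 0 v = 0"
  by (simp add: poly_apply_def)

lemma poly_apply_pCons: "poly_apply T (pCons a p) v = a *\<^sub>C v + T (poly_apply T p v)"
  \<comment> \<open>\<open>pCons 0 0\<close> collapses to \<open>0\<close>, and there the equation
    amounts to \<open>T 0 = 0\<close>.\<close>
  using linear_between_0[OF lin sub] by (cases "p = 0"; cases "a = 0") (auto simp: poly_apply_def)

lemma poly_apply_mem: "poly_apply T p v \<in> V"
  by (induction p)
    (auto simp: poly_apply_0 poly_apply_pCons complex_vector.subspace_0[OF sub] v
      intro!: complex_vector.subspace_add[OF sub] complex_vector.subspace_scale[OF sub]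
        linear_betweenD(1)[OF lin])

lemma poly_apply_add: "poly_apply T (p + q) v = poly_apply T p v + poly_apply T q v"
proof (induction p q rule: poly_induct2)
  case (pCons a p b q)
  then show ?case
    by (simp add: poly_apply_pCons linear_betweenD(2)[OF lin] poly_apply_mem
        complex_vector.scale_left_distrib)
qed (simp add: poly_apply_0)

lemma poly_apply_smult: "poly_apply T (smult c p) v = c *\<^sub>C poly_apply T p v"
  by (induction p)
    (simp_all add: poly_apply_0 poly_apply_pCons linear_betweenD(3)[OF lin] poly_apply_mem
      complex_vector.scale_right_distrib)

lemma poly_apply_sum: "poly_apply T (sum f I) v = (\<Sum>i\<in>I. poly_apply T (f i) v)"
  by (induction I rule: infinite_finite_induct) (simp_all add: poly_apply_0 poly_apply_add)

text \<open>Split off a root \<open>c\<close> of \<open>p\<close>, so that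
  \<open>p = (X - c) q\<close>. Either \<open>q(T) v\<close> is an eigenvector for \<open>c\<close>,
  or \<open>q\<close> is an annihilating polynomial of smaller degree.\<close>

lemma eigenvector_of_annihilating_poly:
  assumes "p \<noteq> 0" "poly_apply T p v = 0" "v \<noteq> 0"
  shows "\<exists>c. \<exists>w\<in>V. w \<noteq> 0 \<and> T w = c *\<^sub>C w"
  using assms(1,2)
proof (induction "degree p" arbitrary: p rule: less_induct)
  case less
  show ?case
  proof (cases "degree p = 0")
    case True
    then obtain a where "p = [:a:]" by (metis degree_eq_zeroE)
    with less.prems have "a *\<^sub>C v = 0" "a \<noteq> 0"
      by (auto simp: poly_apply_pCons poly_apply_0 linear_between_0[OF lin sub])
    with \<open>v \<noteq> 0\<close> show ?thesis by simp
  next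
    case False
    then obtain c where "poly p c = 0"
      using fundamental_theorem_of_algebra[of p] by (auto simp: constant_degree)
    then obtain q where q: "p = [:- c, 1:] * q"
      by (auto simp: poly_eq_0_iff_dvd)
    with less.prems have "q \<noteq> 0" by auto
    then have "degree q < degree p"
      unfolding q by (subst degree_mult_eq) auto
    \<comment> \<open>The product \<open>(X - c) q\<close> is written as a sum because
      \<open>poly_apply\<close> is computed for sums, scalar multiples and \<open>pCons\<close>
      only.\<close>
    have "p = smult (- c) q + pCons 0 q"
      by (simp add: q)
    then have eq: "poly_apply T p v = T (poly_apply T q v) - c *\<^sub>C poly_apply T q v"
      by (simp only: poly_apply_add poly_apply_smult) (simp add: poly_apply_pCons)
    show ?thesis
    proof (cases "poly_apply T q v = 0")
      case True
      show ?thesis by (rule less.hyps[OF \<open>degree q < degree p\<close> \<open>q \<noteq> 0\<close> True])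
    next
      case False
      with eq less.prems show ?thesis
        by (auto intro!: exI[of _ c] bexI[of _ "poly_apply T q v"] poly_apply_mem)
    qed
  qed
qed

text \<open>The vectors \<open>T^i v\<close> for \<open>i\<close> from \<open>0\<close> to
  \<open>card B\<close> are one too many to be independent in the span of \<open>B\<close>.\<close>

lemma ex_annihilating_poly:
  assumes "finite B" "V \<subseteq> complex_vector.span B"
  shows "\<exists>p. p \<noteq> 0 \<and> poly_apply T p v = 0"
proof (rule ccontr)
  assume "\<nexists>p. p \<noteq> 0 \<and> poly_apply T p v = 0"
  then have nz: "p = 0" if "poly_apply T p v = 0" for p
    using that by blast
  define t where "t i = poly_apply T (monom 1 i) v" for i
  have "inj t"
  proof (rule injI)
    fix i j assume "t i = t j"
    then have "poly_apply T (monom 1 i + smult (- 1) (monom 1 j)) v = 0"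
      by (simp only: poly_apply_add poly_apply_smult t_def) simp
    from nz[OF this] have "monom (1 :: complex) i = monom 1 j"
      by simp
    then show "i = j"
      by (metis coeff_monom zero_neq_one)
  qed
  have "complex_vector.independent (t ` {..card B})"
  proof (subst complex_vector.dependent_finite)
    show "\<not> (\<exists>u. (\<exists>x\<in>t ` {..card B}. u x \<noteq> 0) \<and> (\<Sum>x\<in>t ` {..card B}. u x *\<^sub>C x) = 0)"
    proof safe
      fix u k
      assume nonzero: "u (t k) \<noteq> 0" and k: "k \<le> card B"
        and "(\<Sum>x\<in>t ` {..card B}. u x *\<^sub>C x) = 0"
      then have "(\<Sum>i\<le>card B. u (t i) *\<^sub>C t i) = 0"
        by (subst (asm) sum.reindex) (use \<open>inj t\<close> in \<open>auto intro: inj_on_subset\<close>)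
      then have "poly_apply T (\<Sum>i\<le>card B. smult (u (t i)) (monom 1 i)) v = 0"
        by (simp only: poly_apply_sum poly_apply_smult t_def)
      from nz[OF this] have "coeff (\<Sum>i\<le>card B. smult (u (t i)) (monom 1 i)) k = 0"
        by simp
      then show False
        using k nonzero by (simp add: coeff_sum if_distrib cong: if_cong)
    qed
  qed simp
  moreover have "t ` {..card B} \<subseteq> complex_vector.span B"
    using assms(2) poly_apply_mem by (auto simp: t_def)
  ultimately have "card (t ` {..card B}) \<le> card B"
    using complex_vector.independent_span_bound[OF assms(1)] by blast
  moreover have "card (t ` {..card B}) = card B + 1"
    using \<open>inj t\<close> by (subst card_image) (auto intro: inj_on_subset)
  ultimately show False by simp
qed

end

lemma ex_eigenvector:
  fixes V :: "'v::complex_vector set"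
  assumes "linear_between V V T" "complex_vector.subspace V" "V \<noteq> {0}"
    and "finite B" "V \<subseteq> complex_vector.span B"
  shows "\<exists>c. \<exists>w\<in>V. w \<noteq> 0 \<and> T w = c *\<^sub>C w"
proof -
  obtain v where v: "v \<in> V" "v \<noteq> 0"
    using assms(3) complex_vector.subspace_0[OF assms(2)] by blast
  obtain p where "p \<noteq> 0" "poly_apply T p v = 0"
    using ex_annihilating_poly[OF assms(1,2) v(1) assms(4,5)] by blast
  with v show ?thesis
    using eigenvector_of_annihilating_poly[OF assms(1,2) v(1)] by blast
qed

section \<open>Irreducible representations\<close>

lemma group_repD:
  assumes "group_rep G \<rho>"
  shows "complex_vector.subspace (rep_space \<rho>)"
    and "g \<in> carrier G \<Longrightarrow> linear_between (rep_space \<rho>) (rep_space \<rho>) (rep_act \<rho> g)"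
    and "v \<in> rep_space \<rho> \<Longrightarrow> rep_act \<rho> \<one>\<^bsub>G\<^esub> v = v"
    and "g \<in> carrier G \<Longrightarrow> h \<in> carrier G \<Longrightarrow> v \<in> rep_space \<rho> \<Longrightarrow>
      rep_act \<rho> (g \<otimes>\<^bsub>G\<^esub> h) v = rep_act \<rho> g (rep_act \<rho> h v)"
    and "g \<in> carrier G \<Longrightarrow> v \<in> rep_space \<rho> \<Longrightarrow> rep_act \<rho> g v \<in> rep_space \<rho>"
  using assms by (auto simp: group_rep_def linear_between_def)

lemma invariant_subspaceD:
  assumes "invariant_subspace G \<rho> W"
  shows "complex_vector.subspace W" "W \<subseteq> rep_space \<rho>"
    and "g \<in> carrier G \<Longrightarrow> v \<in> W \<Longrightarrow> rep_act \<rho> g v \<in> W"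
  using assms by (auto simp: invariant_subspace_def)

lemma linear_between_subset:
  assumes "linear_between V W T" "V' \<subseteq> V" "\<And>x. x \<in> V' \<Longrightarrow> T x \<in> W'"
  shows "linear_between V' W' T"
  using assms unfolding linear_between_def by blast

lemma group_rep_invariant_subspace:
  assumes "group_rep G \<rho>" "invariant_subspace G \<rho> S"
  shows "group_rep G (\<rho>\<lparr>rep_space := S\<rparr>)"
proof -
  note S = invariant_subspaceD[OF assms(2)]
  have "linear_between S S (rep_act \<rho> g)" if "g \<in> carrier G" for g
    using linear_between_subset[OF group_repD(2)[OF assms(1) that] S(2)] S(3)[OF that] by blast
  with S assms(1) show ?thesis
    by (auto simp: group_rep_def subset_iff)
qed

lemma irreducible_rep_eqI:
  assumes "irreducible_rep G \<sigma>" "complex_vector.subspace W" "W \<subseteq> rep_space \<sigma>"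
    and "\<And>g v. g \<in> carrier G \<Longrightarrow> v \<in> W \<Longrightarrow> rep_act \<sigma> g v \<in> W"
    and "w \<in> W" "w \<noteq> 0"
  shows "W = rep_space \<sigma>"
  using assms unfolding irreducible_rep_def invariant_subspace_def by blast

text \<open>The orbit of one nonzero vector is finite, and its span is invariant, hence the whole
  space.\<close>

lemma irreducible_rep_finite_dim:
  assumes "group G" "finite (carrier G)" "irreducible_rep G \<sigma>"
  shows "\<exists>B. finite B \<and> rep_space \<sigma> \<subseteq> complex_vector.span B"
proof -
  interpret group G by fact
  have rep: "group_rep G \<sigma>" and "rep_space \<sigma> \<noteq> {0}"
    using assms(3) by (auto simp: irreducible_rep_def)
  note r = group_repD[OF rep]
  obtain w where w: "w \<in> rep_space \<sigma>" "w \<noteq> 0"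
    using \<open>rep_space \<sigma> \<noteq> {0}\<close> complex_vector.subspace_0[OF r(1)] by blast
  define B where "B = (\<lambda>g. rep_act \<sigma> g w) ` carrier G"
  define S where "S = complex_vector.span B"
  have "B \<subseteq> rep_space \<sigma>"
    using r(5) w by (auto simp: B_def)
  then have sub: "S \<subseteq> rep_space \<sigma>"
    unfolding S_def by (rule complex_vector.span_minimal[OF _ r(1)])
  have "rep_act \<sigma> g v \<in> S" if g: "g \<in> carrier G" and "v \<in> S" for g v
  proof -
    \<comment> \<open>Membership of \<open>v\<close> in the space is carried through the induction,
      since the action is known to be linear only there.\<close>
    have "v \<in> rep_space \<sigma> \<and> rep_act \<sigma> g v \<in> S"
      using \<open>v \<in> S\<close> unfolding S_def
    proof (induction rule: complex_vector.span_induct_alt)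
      case base
      show ?case
        by (simp add: linear_between_0[OF r(2)[OF g] r(1)] complex_vector.span_zero
            complex_vector.subspace_0[OF r(1)])
    next
      case (step c x y)
      then obtain h where h: "h \<in> carrier G" "x = rep_act \<sigma> h w"
        by (auto simp: B_def)
      have x: "x \<in> rep_space \<sigma>"
        using h r(5) w by blast
      have "rep_act \<sigma> g x = rep_act \<sigma> (g \<otimes>\<^bsub>G\<^esub> h) w"
        using h g w r(4) by simp
      then have "rep_act \<sigma> g x \<in> complex_vector.span B"
        using g h by (auto simp: B_def intro!: complex_vector.span_base)
      with step x show ?case
        by (auto simp: linear_betweenD(2,3)[OF r(2)[OF g]] complex_vector.subspace_scale[OF r(1)]
            intro!: complex_vector.subspace_add[OF r(1)] complex_vector.span_add
              complex_vector.span_scale)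
    qed
    then show ?thesis ..
  qed
  moreover have "w \<in> S"
    unfolding S_def B_def using r(3)[OF w(1)] one_closed
    by (intro complex_vector.span_base) (metis imageI)
  ultimately have "S = rep_space \<sigma>"
    using irreducible_rep_eqI[OF assms(3) _ sub] w(2) complex_vector.subspace_span
    unfolding S_def by blast
  then show ?thesis
    using assms(2) by (auto simp: S_def B_def)
qed

text \<open>\<open>T\<close> has an eigenvector by finite dimension, and the eigenspace is invariant
  because \<open>T\<close> commutes with the action.\<close>

lemma schur_scalar:
  assumes "irreducible_rep G \<sigma>" "intertwiner G \<sigma> \<sigma> T"
    and "finite B" "rep_space \<sigma> \<subseteq> complex_vector.span B"
  shows "\<exists>c. \<forall>v\<in>rep_space \<sigma>. T v = c *\<^sub>C v"
proof -
  have rep: "group_rep G \<sigma>" and "rep_space \<sigma> \<noteq> {0}"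
    using assms(1) by (auto simp: irreducible_rep_def)
  note r = group_repD[OF rep]
  have lin: "linear_between (rep_space \<sigma>) (rep_space \<sigma>) T"
    and comm: "\<And>g v. g \<in> carrier G \<Longrightarrow> v \<in> rep_space \<sigma> \<Longrightarrow>
      T (rep_act \<sigma> g v) = rep_act \<sigma> g (T v)"
    using assms(2) by (auto simp: intertwiner_def)
  obtain c w where w: "w \<in> rep_space \<sigma>" "w \<noteq> 0" "T w = c *\<^sub>C w"
    using ex_eigenvector[OF lin r(1) \<open>rep_space \<sigma> \<noteq> {0}\<close> assms(3,4)] by blast
  define K where "K = {v \<in> rep_space \<sigma>. T v = c *\<^sub>C v}"
  have "complex_vector.subspace K"
    by (rule complex_vector.subspaceI)
      (auto simp: K_def linear_betweenD(2,3)[OF lin] linear_between_0[OF lin r(1)]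
        complex_vector.scale_right_distrib complex_vector.scale_left_commute
        intro: complex_vector.subspace_add[OF r(1)] complex_vector.subspace_scale[OF r(1)]
          complex_vector.subspace_0[OF r(1)])
  then have "K = rep_space \<sigma>"
    by (rule irreducible_rep_eqI[OF assms(1)])
      (use w in \<open>auto simp: K_def comm r(5) linear_betweenD(3)[OF r(2)]\<close>)
  then show ?thesis
    by (auto simp: K_def)
qed

text \<open>Among the nonzero invariant subspaces of \<open>W\<close>, one of least dimension is
  irreducible.\<close>

lemma ex_irreducible_subrep:
  assumes "group_rep G \<rho>" "invariant_subspace G \<rho> W" "W \<noteq> {0}"
    and "finite B" "rep_space \<rho> \<subseteq> complex_vector.span B"
  shows "\<exists>S\<subseteq>W. invariant_subspace G \<rho> S \<and> irreducible_rep G (\<rho>\<lparr>rep_space := S\<rparr>)"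
proof -
  define P where "P S \<longleftrightarrow> S \<subseteq> W \<and> invariant_subspace G \<rho> S \<and> S \<noteq> {0}" for S
  have "P W"
    using assms by (auto simp: P_def)
  then obtain S where S: "P S" "\<And>S'. P S' \<Longrightarrow> complex_vector.dim S \<le> complex_vector.dim S'"
    using arg_min_nat_lemma[of P W complex_vector.dim] by blast
  note inv = invariant_subspaceD[of G \<rho> S]
  have "S' = S" if S': "S' \<subseteq> S" "S' \<noteq> {0}" "invariant_subspace G \<rho> S'" for S'
  proof -
    have "P S'"
      using S' S(1) by (auto simp: P_def)
    obtain C where C: "C \<subseteq> S'" "complex_vector.independent C" "S' \<subseteq> complex_vector.span C"
      "card C = complex_vector.dim S'"
      by (rule complex_vector.basis_exists)
    \<comment> \<open>A basis \<open>C\<close> of \<open>S'\<close> is extended to a basis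
      \<open>D\<close> of \<open>S\<close>. Minimality of the dimension leaves no room for new
      vectors, so \<open>C = D\<close> and \<open>S' = S\<close>.\<close>
    obtain D where D: "C \<subseteq> D" "D \<subseteq> S" "complex_vector.independent D"
      "S \<subseteq> complex_vector.span D"
      using complex_vector.maximal_independent_subset_extend[of C S] C S' by blast
    have "D \<subseteq> complex_vector.span B"
      using D(2) S(1) inv(2) assms(5) by (auto simp: P_def)
    then have "finite D"
      using complex_vector.independent_span_bound[OF assms(4) D(3)] by blast
    have "card D = complex_vector.dim S"
      by (rule complex_vector.basis_card_eq_dim[OF D(2,4,3)])
    with S(2)[OF \<open>P S'\<close>] C(4) have "card D \<le> card C" by simp
    then have "C = D"
      using card_seteq[OF \<open>finite D\<close> D(1)] by blast
    moreover have "complex_vector.span C \<subseteq> S'"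
      by (rule complex_vector.span_minimal[OF C(1) invariant_subspaceD(1)[OF S'(3)]])
    ultimately show "S' = S"
      using D(4) S'(1) by blast
  qed
  moreover have "group_rep G (\<rho>\<lparr>rep_space := S\<rparr>)"
    using S(1) group_rep_invariant_subspace[OF assms(1)] by (auto simp: P_def)
  moreover have "invariant_subspace G \<rho> S'" if "invariant_subspace G (\<rho>\<lparr>rep_space := S\<rparr>) S'" for S'
    using that S(1) inv(2) by (auto simp: P_def invariant_subspace_def)
  ultimately have "irreducible_rep G (\<rho>\<lparr>rep_space := S\<rparr>)"
    using S(1) by (auto simp: irreducible_rep_def P_def invariant_subspace_def[of _ "\<rho>\<lparr>rep_space := S\<rparr>"])
  with S(1) show ?thesis
    by (auto simp: P_def)
qed

section \<open>Whittaker functionals\<close>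

lemma mult_GL2: "A \<otimes>\<^bsub>GL2\<^esub> B = A ** B"
  by (simp add: GL2_def)

lemma carrier_GL2_iff:
  "A \<in> carrier (GL2 :: ('a::field ^ 2 ^ 2) monoid) \<longleftrightarrow> A $ 1 $ 1 * A $ 2 $ 2 - A $ 1 $ 2 * A $ 2 $ 1 \<noteq> 0"
  by (simp add: GL2_def invertible_det_nz det_2)

lemma mult_in_GL2: "A \<in> carrier GL2 \<Longrightarrow> B \<in> carrier GL2 \<Longrightarrow> A ** B \<in> carrier GL2"
  by (simp add: GL2_def invertible_mult)

lemma additive_characterD:
  assumes "additive_character \<psi>"
  shows "\<psi> (x + y) = \<psi> x * \<psi> y" "\<psi> 0 = 1" "\<psi> (- x) * \<psi> x = 1"
proof -
  show add: "\<psi> (x + y) = \<psi> x * \<psi> y" for x y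
    using assms unfolding additive_character_def by blast
  have "\<psi> 0 * \<psi> 0 = \<psi> 0" "cmod (\<psi> 0) = 1"
    using add[of 0 0] assms by (auto simp: additive_character_def)
  then show "\<psi> 0 = 1" by auto
  with add[of "- x" x] show "\<psi> (- x) * \<psi> x = 1" by simp
qed

lemma sum_UNIV_shift: "(\<Sum>b\<in>UNIV. f (b + x)) = (\<Sum>b\<in>UNIV. f (b :: 'a::{ab_group_add, finite}))"
  by (rule sum.reindex_bij_witness[of _ "\<lambda>b. b - x" "\<lambda>b. b + x"]) auto

text \<open>The transpose conjugated by the Weyl element. It reverses products and, unlike the
  transpose itself, fixes \<open>U\<close> pointwise.\<close>

definition swap_diag :: "'a::field ^ 2 ^ 2 \<Rightarrow> 'a ^ 2 ^ 2" where
  "swap_diag A = vector [vector [A $ 2 $ 2, A $ 1 $ 2], vector [A $ 2 $ 1, A $ 1 $ 1]]"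

lemma swap_diag_mult: "swap_diag (A ** B) = swap_diag B ** swap_diag A"
  by (simp add: swap_diag_def vec_eq_iff forall_2 matrix_matrix_mult_def sum_2 algebra_simps)

lemma swap_diag_unipotent: "swap_diag (unipotent b) = unipotent b"
  by (simp add: swap_diag_def unipotent_def)

lemma swap_diag_in_GL2: "A \<in> carrier GL2 \<Longrightarrow> swap_diag A \<in> carrier GL2"
  by (simp add: carrier_GL2_iff swap_diag_def algebra_simps)

section \<open>Whittaker projection and Hecke operators\<close>

definition whittaker_proj ::
    "('a::{field, finite} \<Rightarrow> complex) \<Rightarrow> ('a ^ 2 ^ 2, 'v::complex_vector) rep \<Rightarrow> 'v \<Rightarrow> 'v" where
  "whittaker_proj \<psi> \<sigma> v = (\<Sum>b\<in>UNIV. \<psi> (- b) *\<^sub>C rep_act \<sigma> (unipotent b) v)"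

text \<open>Up to scalars, these are the actions on \<open>\<sigma>\<close> of the elements
  \<open>e g e\<close> spanning the Hecke algebra of \<open>U\<close> and \<open>\<psi>\<close>,
  where \<open>e\<close> is the idempotent of \<open>\<psi>\<close>.\<close>

definition hecke_op ::
    "('a::{field, finite} \<Rightarrow> complex) \<Rightarrow> ('a ^ 2 ^ 2, 'v::complex_vector) rep \<Rightarrow> 'a ^ 2 ^ 2 \<Rightarrow> 'v \<Rightarrow> 'v"
  where "hecke_op \<psi> \<sigma> g v = whittaker_proj \<psi> \<sigma> (rep_act \<sigma> g (whittaker_proj \<psi> \<sigma> v))"

context
  fixes \<psi> :: "'a::{field, finite} \<Rightarrow> complex"
    and \<sigma> :: "('a ^ 2 ^ 2, 'v::complex_vector) rep"
  assumes character: "additive_character \<psi>" and rep: "group_rep GL2 \<sigma>"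
begin

private abbreviation (input) "V \<equiv> rep_space \<sigma>"
private abbreviation (input) "act \<equiv> rep_act \<sigma>"
private abbreviation (input) "E \<equiv> whittaker_proj \<psi> \<sigma>"
private abbreviation (input) "H \<equiv> hecke_op \<psi> \<sigma>"

private lemmas \<psi> = additive_characterD[OF character]
private lemmas sub = group_repD(1)[OF rep]
private lemmas lin = group_repD(2)[OF rep]
private lemmas act_mem = group_repD(5)[OF rep]

private lemma act_mult:
  "g \<in> carrier GL2 \<Longrightarrow> h \<in> carrier GL2 \<Longrightarrow> v \<in> V \<Longrightarrow> act (g ** h) v = act g (act h v)"
  using group_repD(4)[OF rep] by (simp add: mult_GL2)

lemma whittaker_proj_linear: "linear_between V V E"
  unfolding linear_between_def whittaker_proj_def
  by (auto simp: linear_betweenD(2,3)[OF lin] unipotent_in_GL2 act_mem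
      complex_vector.scale_right_distrib sum.distrib complex_vector.scale_sum_right mult.commute
      intro!: complex_vector.subspace_sum[OF sub] complex_vector.subspace_scale[OF sub])

private lemmas E_mem = linear_betweenD(1)[OF whittaker_proj_linear]

text \<open>Reindexing the sum by \<open>b + x\<close> splits off the factor
  \<open>\<psi> x\<close>.\<close>

lemma whittaker_proj_act_unipotent:
  assumes "v \<in> V"
  shows "E (act (unipotent x) v) = \<psi> x *\<^sub>C E v"
proof -
  have "E (act (unipotent x) v) = (\<Sum>b\<in>UNIV. \<psi> (- b) *\<^sub>C act (unipotent (b + x)) v)"
    unfolding whittaker_proj_def
    by (simp add: act_mult[symmetric] unipotent_in_GL2 assms unipotent_mult)
  also have "\<dots> = (\<Sum>b\<in>UNIV. (\<psi> x * \<psi> (- (b + x))) *\<^sub>C act (unipotent (b + x)) v)"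
    using \<psi>(1)[of x "- (b + x)" for b] by simp
  also have "\<dots> = (\<Sum>b\<in>UNIV. (\<psi> x * \<psi> (- b)) *\<^sub>C act (unipotent b) v)"
    by (rule sum_UNIV_shift)
  finally show ?thesis
    by (simp add: whittaker_proj_def complex_vector.scale_sum_right)
qed

lemma act_unipotent_whittaker_proj:
  assumes "v \<in> V"
  shows "act (unipotent x) (E v) = \<psi> x *\<^sub>C E v"
proof -
  have "act (unipotent x) (E v) = (\<Sum>b\<in>UNIV. \<psi> (- b) *\<^sub>C act (unipotent x) (act (unipotent b) v))"
    unfolding whittaker_proj_def
    by (subst linear_between_sum[OF lin sub])
      (auto simp: unipotent_in_GL2 linear_betweenD(3)[OF lin] act_mem assms
        intro!: complex_vector.subspace_scale[OF sub])
  \<comment> \<open>\<open>U\<close> is commutative, so the translation can be moved to the inside,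
    where the previous lemma evaluates it.\<close>
  also have "\<dots> = (\<Sum>b\<in>UNIV. \<psi> (- b) *\<^sub>C act (unipotent b) (act (unipotent x) v))"
    by (simp add: act_mult[symmetric] unipotent_in_GL2 assms unipotent_mult add.commute)
  also have "\<dots> = E (act (unipotent x) v)"
    by (simp add: whittaker_proj_def)
  finally show ?thesis
    by (simp add: whittaker_proj_act_unipotent assms)
qed

text \<open>\<open>U\<close> acts on the image of \<open>E\<close> through \<open>\<psi>\<close>, so
  each summand of \<open>E (E v)\<close> is \<open>E v\<close>.\<close>

lemma whittaker_proj_idem:
  assumes "v \<in> V"
  shows "E (E v) = of_nat CARD('a) *\<^sub>C E v"
proof -
  have "E (E v) = (\<Sum>b\<in>(UNIV :: 'a set). E v)"
    using \<psi>(3)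
    by (subst whittaker_proj_def) (simp add: act_unipotent_whittaker_proj assms)
  also have "\<dots> = (\<Sum>b\<in>(UNIV :: 'a set). 1) *\<^sub>C E v"
    unfolding complex_vector.scale_sum_left by simp
  finally show ?thesis by simp
qed

lemma hecke_op_mem: "g \<in> carrier GL2 \<Longrightarrow> v \<in> V \<Longrightarrow> H g v \<in> V"
  by (simp add: hecke_op_def E_mem act_mem)

text \<open>Together with its right-hand counterpart, this shows that \<open>H g\<close> depends, up
  to a known scalar, only on the double coset of \<open>g\<close> modulo \<open>U\<close>.\<close>

lemma hecke_op_unipotent_left:
  assumes "g \<in> carrier GL2" "v \<in> V"
  shows "H (unipotent x ** g) v = \<psi> x *\<^sub>C H g v"
  using assms
  by (simp add: hecke_op_def act_mult unipotent_in_GL2 E_mem act_mem whittaker_proj_act_unipotent)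

lemma hecke_op_unipotent_right:
  assumes "g \<in> carrier GL2" "v \<in> V"
  shows "H (g ** unipotent x) v = \<psi> x *\<^sub>C H g v"
  using assms
  by (simp add: hecke_op_def act_mult unipotent_in_GL2 E_mem act_mem act_unipotent_whittaker_proj
      linear_betweenD(3)[OF lin] linear_betweenD(3)[OF whittaker_proj_linear])

lemma hecke_op_linear: "g \<in> carrier GL2 \<Longrightarrow> linear_between V V (H g)"
  unfolding linear_between_def
  by (auto simp: hecke_op_def E_mem act_mem linear_betweenD(2,3)[OF lin]
      linear_betweenD(2,3)[OF whittaker_proj_linear])

text \<open>In \<open>E g E E h E\<close> the two adjacent copies of \<open>E\<close> merge into a
  multiple of \<open>E\<close>, which is then expanded over \<open>U\<close>. Composition is thereby
  reduced to single operators \<open>H\<close>, to which the anti-involution applies.\<close>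

lemma hecke_op_compose:
  assumes "g \<in> carrier GL2" "h \<in> carrier GL2" "v \<in> V"
  shows "H g (H h v) =
    of_nat CARD('a) *\<^sub>C (\<Sum>b\<in>UNIV. \<psi> (- b) *\<^sub>C H (g ** unipotent b ** h) v)"
proof -
  let ?w = "act h (E v)"
  have w: "?w \<in> V"
    using assms by (simp add: act_mem E_mem)
  have "H g (H h v) = of_nat CARD('a) *\<^sub>C E (act g (E ?w))"
    using assms w by (simp add: hecke_op_def whittaker_proj_idem linear_betweenD(3)[OF lin]
        linear_betweenD(3)[OF whittaker_proj_linear] act_mem E_mem)
  also have "act g (E ?w) = (\<Sum>b\<in>UNIV. \<psi> (- b) *\<^sub>C act g (act (unipotent b) ?w))"
    using assms w unfolding whittaker_proj_def[of _ _ ?w]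
    by (subst linear_between_sum[OF lin sub])
      (auto simp: unipotent_in_GL2 linear_betweenD(3)[OF lin] act_mem
        intro!: complex_vector.subspace_scale[OF sub])
  also have "\<dots> = (\<Sum>b\<in>UNIV. \<psi> (- b) *\<^sub>C act (g ** unipotent b ** h) (E v))"
    using assms w by (simp add: act_mult mult_in_GL2 unipotent_in_GL2 E_mem act_mem)
  also have "E \<dots> = (\<Sum>b\<in>UNIV. \<psi> (- b) *\<^sub>C H (g ** unipotent b ** h) v)"
    using assms
    by (subst linear_between_sum[OF whittaker_proj_linear sub])
      (auto simp: unipotent_in_GL2 linear_betweenD(3)[OF whittaker_proj_linear] act_mem E_mem
        mult_in_GL2 hecke_op_def intro!: complex_vector.subspace_scale[OF sub])
  finally show ?thesis .
qed

section \<open>Commuting Hecke operators for a non-trivial character\<close>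

context
  assumes nontrivial: "\<psi> \<noteq> (\<lambda>_. 1)"
begin

text \<open>Conjugation by \<open>g\<close> rescales the entry \<open>x\<close> of
  \<open>unipotent x\<close> by the ratio of the diagonal entries. Absorbing it on the left and on
  the right gives two different scalars for the same vector.\<close>

lemma hecke_op_upper_triangular_eq_0:
  assumes g: "g \<in> carrier GL2" and "g $ 2 $ 1 = 0" "g $ 1 $ 1 \<noteq> g $ 2 $ 2" and v: "v \<in> V"
  shows "H g v = 0"
proof -
  obtain y where y: "\<psi> y \<noteq> 1"
    using nontrivial by blast
  define a d where "a = g $ 1 $ 1" and "d = g $ 2 $ 2"
  \<comment> \<open>Solves \<open>a * x / d - x = y\<close>, so that the two scalars differ by the
    factor \<open>\<psi> y\<close>, which is not \<open>1\<close>.\<close>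
  define x where "x = y * d / (a - d)"
  have "a \<noteq> 0" "d \<noteq> 0" "a \<noteq> d"
    using assms by (auto simp: carrier_GL2_iff a_def d_def)
  then have x: "a * x / d = x + y"
    by (simp add: x_def field_simps)
  have "g ** unipotent x = unipotent (a * x / d) ** g"
    using assms(2) \<open>d \<noteq> 0\<close>
    by (simp add: vec_eq_iff forall_2 matrix_matrix_mult_def sum_2 unipotent_def a_def d_def
        add.commute)
  then have "\<psi> x *\<^sub>C H g v = (\<psi> x * \<psi> y) *\<^sub>C H g v"
    using hecke_op_unipotent_left[OF g v, of "a * x / d"] hecke_op_unipotent_right[OF g v, of x]
    by (simp add: x \<psi>(1))
  moreover have "\<psi> x \<noteq> 0"
    using \<psi>(3)[of x] by auto
  ultimately show ?thesis
    using y by auto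
qed

text \<open>By the Bruhat decomposition, \<open>g\<close> is upper triangular or of the form
  \<open>u m u'\<close> with \<open>m\<close> antidiagonal. In the second case \<open>m\<close> is
  fixed and \<open>u\<close>, \<open>u'\<close> trade places, which leaves the scalar unchanged. In
  the first case \<open>g\<close> is fixed or both sides vanish.\<close>

lemma hecke_op_swap_diag:
  assumes g: "g \<in> carrier GL2" and v: "v \<in> V"
  shows "H (swap_diag g) v = H g v"
proof (cases "g $ 2 $ 1 = 0")
  case True
  show ?thesis
  proof (cases "g $ 1 $ 1 = g $ 2 $ 2")
    case True
    then have "swap_diag g = g"
      by (simp add: swap_diag_def vec_eq_iff forall_2)
    then show ?thesis by simp
  next
    case False
    then have "H (swap_diag g) v = 0"
      using True by (intro hecke_op_upper_triangular_eq_0 swap_diag_in_GL2 g v)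
        (auto simp: swap_diag_def)
    with hecke_op_upper_triangular_eq_0[OF g True False v] show ?thesis by simp
  qed
next
  case False
  define c where "c = g $ 2 $ 1"
  \<comment> \<open>The factors \<open>unipotent x\<close> and \<open>unipotent y\<close> clear the
    diagonal of \<open>g\<close>; the upper right entry left in \<open>m\<close> is
    \<open>- det g / c\<close>.\<close>
  define x y where "x = g $ 1 $ 1 / c" and "y = g $ 2 $ 2 / c"
  define m :: "'a ^ 2 ^ 2" where
    "m = vector [vector [0, g $ 1 $ 2 - g $ 1 $ 1 * g $ 2 $ 2 / c], vector [c, 0]]"
  have c: "c \<noteq> 0"
    using False by (simp add: c_def)
  have eq: "g = unipotent x ** m ** unipotent y"
    using c by (simp add: vec_eq_iff forall_2 matrix_matrix_mult_def sum_2 unipotent_def m_def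
        x_def y_def) (simp add: c_def)
  have m: "m \<in> carrier GL2"
    using g c by (simp add: carrier_GL2_iff m_def field_simps) (simp add: c_def mult.commute)
  have "swap_diag m = m"
    by (simp add: swap_diag_def m_def)
  then have "swap_diag g = unipotent y ** m ** unipotent x"
    by (simp add: eq swap_diag_mult swap_diag_unipotent matrix_mul_assoc)
  then show ?thesis
    by (simp add: eq hecke_op_unipotent_left hecke_op_unipotent_right m v mult_in_GL2
        unipotent_in_GL2 mult.commute)
qed

text \<open>The anti-involution turns \<open>g u h\<close> into \<open>h' u g'\<close>, hence the
  expansion of \<open>H g H h\<close> into that of \<open>H h' H g'\<close>, and \<open>H\<close>
  does not distinguish \<open>g\<close> from \<open>g'\<close>.\<close>

lemma hecke_op_commute:
  assumes "g \<in> carrier GL2" "h \<in> carrier GL2" "v \<in> V"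
  shows "H g (H h v) = H h (H g v)"
proof -
  let ?g = "swap_diag g" and ?h = "swap_diag h"
  have "H (g ** unipotent b ** h) v = H (?h ** unipotent b ** ?g) v" for b
    using hecke_op_swap_diag[of "g ** unipotent b ** h" v] assms
    by (simp add: swap_diag_mult swap_diag_unipotent mult_in_GL2 unipotent_in_GL2 matrix_mul_assoc)
  then have "H g (H h v) = H ?h (H ?g v)"
    using assms by (simp add: hecke_op_compose swap_diag_in_GL2)
  then show ?thesis
    using assms by (simp add: hecke_op_swap_diag hecke_op_mem)
qed

text \<open>The operators \<open>H g\<close> commute and act irreducibly on the image
  \<open>W\<close> of \<open>E\<close>. They are therefore scalar on \<open>W\<close>, and
  irreducibility then leaves room for a single line.\<close>

lemma whittaker_proj_image_line:
  assumes irr: "irreducible_rep GL2 \<sigma>"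
  shows "\<exists>w\<in>V. \<forall>v\<in>V. \<exists>c. E v = c *\<^sub>C w"
proof (cases "\<forall>v\<in>V. E v = 0")
  case True
  then show ?thesis
    using complex_vector.subspace_0[OF sub] by (intro bexI[of _ 0]) auto
next
  case False
  define W where "W = E ` V"
  have W_sub: "complex_vector.subspace W"
    by (rule complex_vector.subspaceI)
      (auto simp: W_def linear_between_0[OF whittaker_proj_linear sub]
        linear_betweenD(2,3)[OF whittaker_proj_linear, symmetric]
        intro!: imageI complex_vector.subspace_add[OF sub] complex_vector.subspace_scale[OF sub]
          complex_vector.subspace_0[OF sub]
        intro: rev_image_eqI[OF complex_vector.subspace_0[OF sub]])
  have W_V: "W \<subseteq> V"
    using E_mem by (auto simp: W_def)
  have q: "of_nat CARD('a) \<noteq> (0 :: complex)" by simp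
  have EW: "E w = of_nat CARD('a) *\<^sub>C w" if "w \<in> W" for w
    using that whittaker_proj_idem by (auto simp: W_def)
  have E_act: "of_nat CARD('a) *\<^sub>C E (act g w) = H g w" if "g \<in> carrier GL2" "w \<in> W" for g w
    using that W_V by (auto simp: hecke_op_def EW linear_betweenD(3)[OF lin]
        linear_betweenD(3)[OF whittaker_proj_linear] act_mem)
  \<comment> \<open>Irreducibility of \<open>W\<close> under the Hecke operators. \<open>Y\<close>
    is the largest invariant subspace that \<open>E\<close> maps into \<open>K\<close>; it contains
    \<open>w\<close>, so it is all of \<open>V\<close>.\<close>
  have E_in: "E v \<in> K"
    if K: "complex_vector.subspace K" and w: "w \<in> W" "w \<noteq> 0"
      and HK: "\<And>g. g \<in> carrier GL2 \<Longrightarrow> H g w \<in> K" and v: "v \<in> V" for K w v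
  proof -
    define Y where "Y = {v \<in> V. \<forall>g\<in>carrier GL2. E (act g v) \<in> K}"
    have "complex_vector.subspace Y"
      by (rule complex_vector.subspaceI)
        (auto simp: Y_def linear_betweenD(2,3)[OF lin] act_mem linear_between_0[OF lin sub]
          linear_betweenD(2,3)[OF whittaker_proj_linear]
          linear_between_0[OF whittaker_proj_linear sub]
          intro: complex_vector.subspace_add[OF sub] complex_vector.subspace_scale[OF sub]
            complex_vector.subspace_0[OF sub] complex_vector.subspace_add[OF K]
            complex_vector.subspace_scale[OF K] complex_vector.subspace_0[OF K])
    moreover have "E (act g w) \<in> K" if "g \<in> carrier GL2" for g
      using complex_vector.subspace_scale[OF K HK[OF that], of "inverse (of_nat CARD('a))"] q
      by (simp add: E_act[OF that w(1), symmetric])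
    then have "w \<in> Y"
      using w W_V by (auto simp: Y_def)
    ultimately have "Y = V"
      using w(2) by (intro irreducible_rep_eqI[OF irr])
        (auto simp: Y_def act_mem act_mult[symmetric] mult_in_GL2)
    then have "E (act \<one>\<^bsub>GL2\<^esub> v) \<in> K"
      using v group.is_monoid[OF group_GL2] monoid.one_closed unfolding Y_def by blast
    then show ?thesis
      using group_repD(3)[OF rep v] by simp
  qed
  have scalar: "\<exists>c. \<forall>w\<in>W. H g w = c *\<^sub>C w" if g: "g \<in> carrier GL2" for g
  proof -
    obtain B where B: "finite B" "V \<subseteq> complex_vector.span B"
      using irreducible_rep_finite_dim[OF group_GL2 finite_GL2 irr] by blast
    have "linear_between W W (H g)"
      using W_V g by (intro linear_between_subset[OF hecke_op_linear[OF g] W_V])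
        (auto simp: W_def hecke_op_def act_mem E_mem)
    moreover have "W \<noteq> {0}"
      using False by (auto simp: W_def)
    moreover have "W \<subseteq> complex_vector.span B"
      using W_V B(2) by blast
    ultimately obtain c w where w: "w \<in> W" "w \<noteq> 0" "H g w = c *\<^sub>C w"
      using ex_eigenvector[OF _ W_sub _ B(1)] by blast
    \<comment> \<open>An eigenspace of \<open>H g\<close>. Since every \<open>H h\<close> commutes
      with \<open>H g\<close>, it contains all vectors \<open>H h w\<close>, as \<open>E_in\<close>
      demands.\<close>
    define K where "K = {w \<in> V. H g w = c *\<^sub>C w}"
    have "complex_vector.subspace K"
      by (rule complex_vector.subspaceI)
        (auto simp: K_def linear_betweenD(2,3)[OF hecke_op_linear[OF g]]
          linear_between_0[OF hecke_op_linear[OF g] sub]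
          complex_vector.scale_right_distrib complex_vector.scale_left_commute
          intro: complex_vector.subspace_add[OF sub] complex_vector.subspace_scale[OF sub]
            complex_vector.subspace_0[OF sub])
    moreover have "H h w \<in> K" if h: "h \<in> carrier GL2" for h
      using w W_V hecke_op_commute[OF g h, of w]
      by (auto simp: K_def hecke_op_mem h linear_betweenD(3)[OF hecke_op_linear[OF h]])
    ultimately have "E v \<in> K" if "v \<in> V" for v
      using E_in[of K w v] w that by blast
    then show ?thesis
      by (auto simp: K_def W_def)
  qed
  obtain w where w: "w \<in> W" "w \<noteq> 0"
    using False by (auto simp: W_def)
  \<comment> \<open>With all \<open>H g\<close> scalar on \<open>W\<close>, the line of
    \<open>w\<close> can play the part of \<open>K\<close>.\<close>
  have "H g w \<in> range (\<lambda>c. c *\<^sub>C w)" if "g \<in> carrier GL2" for g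
    using scalar[OF that] w by auto
  moreover have "complex_vector.subspace (range (\<lambda>c. c *\<^sub>C w))"
    using complex_vector.subspace_span[of "{w}"] by (simp add: complex_vector.span_singleton)
  ultimately have "E v \<in> range (\<lambda>c. c *\<^sub>C w)" if "v \<in> V" for v
    using E_in[of _ w v] w that by blast
  with w W_V show ?thesis by blast
qed

end

end

section \<open>Multiplicity one through Frobenius reciprocity\<close>

lemma rep_copies_single:
  assumes "i < m" "v \<in> rep_space \<sigma>" "0 \<in> rep_space \<sigma>"
  shows "(\<lambda>j. if j = i then v else 0) \<in> rep_space (rep_copies m \<sigma>)"
  using assms by (auto simp: rep_copies_def)

text \<open>Evaluation at the identity turns each embedded copy of \<open>\<sigma>\<close> into a
  functional on which \<open>U\<close> acts by \<open>\<psi>\<close>. Such a functional factors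
  through \<open>E\<close>, whose image is at most a line, so any two are proportional; two embedded
  copies would give independent ones.\<close>

lemma multiplicity_free_char_rep:
  fixes \<psi> :: "'a::{field, finite} \<Rightarrow> complex"
  assumes character: "additive_character \<psi>" and nontrivial: "\<psi> \<noteq> (\<lambda>_. 1)"
  shows "multiplicity_free (GL2 :: ('a ^ 2 ^ 2) monoid) (induced_rep GL2 U (char_rep \<psi>))"
  unfolding multiplicity_free_def
proof (intro allI impI)
  fix \<sigma> :: "('a ^ 2 ^ 2, nat \<Rightarrow> complex) rep" and m
  let ?V = "rep_space \<sigma>"
  let ?\<rho> = "induced_rep GL2 U (char_rep \<psi>) :: ('a ^ 2 ^ 2, 'a ^ 2 ^ 2 \<Rightarrow> complex) rep"
  interpret group "GL2 :: ('a ^ 2 ^ 2) monoid" by (rule group_GL2)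
  assume irr: "irreducible_rep GL2 \<sigma>" and "contains_rep GL2 ?\<rho> (rep_copies m \<sigma>)"
  then obtain T where T: "intertwiner GL2 (rep_copies m \<sigma>) ?\<rho> T"
    and inj: "inj_on T (rep_space (rep_copies m \<sigma>))"
    by (auto simp: contains_rep_def)
  have rep: "group_rep GL2 \<sigma>" and "?V \<noteq> {0}"
    using irr by (auto simp: irreducible_rep_def)
  note r = group_repD[OF rep]
  note zero = complex_vector.subspace_0[OF r(1)]
  have T_lin: "linear_between (rep_space (rep_copies m \<sigma>)) (rep_space ?\<rho>) T"
    and T_act: "\<And>g f. g \<in> carrier GL2 \<Longrightarrow> f \<in> rep_space (rep_copies m \<sigma>) \<Longrightarrow>
      T (rep_act (rep_copies m \<sigma>) g f) = rep_act ?\<rho> g (T f)"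
    using T by (auto simp: intertwiner_def)
  have copies_sub: "complex_vector.subspace (rep_space (rep_copies m \<sigma>))"
    by (rule complex_vector.subspaceI)
      (auto simp: rep_copies_def scaleC_fun_apply zero intro: complex_vector.subspace_add[OF r(1)]
        complex_vector.subspace_scale[OF r(1)])
  define single where "single i v = (\<lambda>j::nat. if j = i then v else 0)" for i and v :: "nat \<Rightarrow> complex"
  \<comment> \<open>\<open>P i\<close> embeds the \<open>i\<close>-th copy; its value at the
    identity is the functional of Frobenius reciprocity.\<close>
  define P where "P i v = T (single i v)" for i v
  have single_mem: "single i v \<in> rep_space (rep_copies m \<sigma>)" if "i < m" "v \<in> ?V" for i v
    unfolding single_def by (rule rep_copies_single[OF that zero])
  have single_add: "single i (v + w) = single i v + single i w" for i v w
    by (auto simp: single_def fun_eq_iff)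
  have single_scale: "single i (c *\<^sub>C v) = c *\<^sub>C single i v" for i c v
    by (auto simp: single_def fun_eq_iff scaleC_fun_apply)
  have P_lin: "linear_between ?V (rep_space ?\<rho>) (P i)" if "i < m" for i
    using linear_betweenD[OF T_lin] single_mem[OF that]
    by (auto simp: linear_between_def P_def single_add single_scale)
  have P_act: "P i (rep_act \<sigma> g v) = rep_act ?\<rho> g (P i v)"
    if "i < m" "g \<in> carrier GL2" "v \<in> ?V" for i g v
  proof -
    have "rep_act (rep_copies m \<sigma>) g (single i v) = single i (rep_act \<sigma> g v)"
      using \<open>i < m\<close> linear_between_0[OF r(2)[OF that(2)] r(1)]
      by (auto simp: rep_copies_def single_def fun_eq_iff)
    with T_act[OF that(2) single_mem[OF that(1,3)]] show ?thesis
      by (simp add: P_def)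
  qed
  have P_mem: "P i v \<in> rep_space ?\<rho>" if "i < m" "v \<in> ?V" for i v
    using linear_betweenD(1)[OF P_lin] that by blast
  \<comment> \<open>The functional determines the embedding, since translation carries every point
    to the identity.\<close>
  have P_value: "P i v g = P i (rep_act \<sigma> (inv\<^bsub>GL2\<^esub> g) v) \<one>\<^bsub>GL2\<^esub>"
    if "i < m" "g \<in> carrier GL2" "v \<in> ?V" for i g v
    using that by (simp add: P_act) (simp add: induced_rep_def)
  have P_unipotent: "P i (rep_act \<sigma> (unipotent x) v) \<one>\<^bsub>GL2\<^esub> = \<psi> x * P i v \<one>\<^bsub>GL2\<^esub>"
    if "i < m" "v \<in> ?V" for i x v
  proof -
    have u: "unipotent x \<in> carrier GL2" "inv\<^bsub>GL2\<^esub> unipotent x \<in> (U :: ('a ^ 2 ^ 2) set)"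
      using subgroup.m_inv_closed[OF subgroup_U, of "unipotent x"]
      by (auto simp: U_def unipotent_in_GL2)
    have "P i (rep_act \<sigma> (unipotent x) v) \<one>\<^bsub>GL2\<^esub> =
        P i v (\<one>\<^bsub>GL2\<^esub> \<otimes>\<^bsub>GL2\<^esub> inv\<^bsub>GL2\<^esub> unipotent x)"
      using that u by (simp add: P_act) (simp add: induced_rep_def)
    \<comment> \<open>The inverse from the left translation and the one in the covariance condition
      cancel.\<close>
    also have "\<dots> = \<psi> ((inv\<^bsub>GL2\<^esub> (inv\<^bsub>GL2\<^esub> unipotent x)) $ 1 $ 2) * P i v \<one>\<^bsub>GL2\<^esub>"
      using P_mem[OF that] u(2) one_closed by (auto simp only: induced_rep_def char_rep_def rep.simps)
    also have "\<dots> = \<psi> x * P i v \<one>\<^bsub>GL2\<^esub>"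
      using u(1) by (simp add: unipotent_entry)
    finally show ?thesis .
  qed
  have P_proj: "P i (whittaker_proj \<psi> \<sigma> v) \<one>\<^bsub>GL2\<^esub> = of_nat CARD('a) * P i v \<one>\<^bsub>GL2\<^esub>"
    if "i < m" "v \<in> ?V" for i v
  proof -
    have "P i (whittaker_proj \<psi> \<sigma> v) \<one>\<^bsub>GL2\<^esub> =
        (\<Sum>b\<in>UNIV. \<psi> (- b) * P i (rep_act \<sigma> (unipotent b) v) \<one>\<^bsub>GL2\<^esub>)"
      unfolding whittaker_proj_def
      using that by (subst linear_between_sum[OF P_lin r(1)])
        (auto simp: sum_fun_apply linear_betweenD(3)[OF P_lin] r(5) unipotent_in_GL2 scaleC_fun_apply
          scaleC_complex_def intro!: complex_vector.subspace_scale[OF r(1)])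
    also have "\<dots> = (\<Sum>b\<in>(UNIV :: 'a set). P i v \<one>\<^bsub>GL2\<^esub>)"
      using additive_characterD(3)[OF character] that
      by (simp add: P_unipotent mult.assoc[symmetric])
    finally show ?thesis by simp
  qed
  show "m \<le> 1"
  proof (rule ccontr)
    assume "\<not> m \<le> 1"
    then have m: "0 < m" "1 < m" by auto
    \<comment> \<open>A relation between the functionals puts \<open>a v\<close> in copy 0 plus
      \<open>b v\<close> in copy 1 into the kernel of the injective \<open>T\<close>.\<close>
    have indep: "a = 0 \<and> b = 0"
      if ab: "\<And>v. v \<in> ?V \<Longrightarrow> a * P 0 v \<one>\<^bsub>GL2\<^esub> + b * P 1 v \<one>\<^bsub>GL2\<^esub> = 0" for a b
    proof -
      obtain v where v: "v \<in> ?V" "v \<noteq> 0"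
        using \<open>?V \<noteq> {0}\<close> zero by blast
      define f where "f = a *\<^sub>C single 0 v + b *\<^sub>C single 1 v"
      have mem: "a *\<^sub>C single 0 v \<in> rep_space (rep_copies m \<sigma>)"
        "b *\<^sub>C single 1 v \<in> rep_space (rep_copies m \<sigma>)"
        using m v by (auto intro!: complex_vector.subspace_scale[OF copies_sub] single_mem)
      then have f: "f \<in> rep_space (rep_copies m \<sigma>)"
        unfolding f_def by (rule complex_vector.subspace_add[OF copies_sub])
      have Tf: "T f = a *\<^sub>C P 0 v + b *\<^sub>C P 1 v"
        using m v mem
        by (simp add: f_def linear_betweenD(2)[OF T_lin] linear_betweenD(3)[OF T_lin] single_mem P_def)
      have "T f g = 0" for g
      proof (cases "g \<in> carrier GL2")
        case True
        then show ?thesis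
          using m v ab[OF r(5)[OF inv_closed[OF True] v(1)]]
          by (simp add: Tf P_value[OF _ True v(1)] scaleC_fun_apply scaleC_complex_def del: One_nat_def)
      next
        case False
        then show ?thesis
          using linear_betweenD(1)[OF T_lin f] by (simp add: induced_rep_def)
      qed
      then have "T f = T 0"
        using linear_between_0[OF T_lin copies_sub] by (simp add: fun_eq_iff)
      with inj f complex_vector.subspace_0[OF copies_sub] have "f = 0"
        by (auto dest: inj_onD)
      then have "f 0 = 0" "f 1 = 0" by simp_all
      with v(2) show ?thesis
        by (simp_all add: f_def single_def scaleC_fun_apply)
    qed
    obtain w where w: "w \<in> ?V" "\<And>v. v \<in> ?V \<Longrightarrow> \<exists>c. whittaker_proj \<psi> \<sigma> v = c *\<^sub>C w"
      using whittaker_proj_image_line[OF character rep nontrivial irr] by blast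
    have line: "\<exists>c. \<forall>i<m. of_nat CARD('a) * P i v \<one>\<^bsub>GL2\<^esub> = c * P i w \<one>\<^bsub>GL2\<^esub>" if v: "v \<in> ?V" for v
    proof -
      obtain c where "whittaker_proj \<psi> \<sigma> v = c *\<^sub>C w"
        using w(2)[OF v] by blast
      then show ?thesis
        using P_proj[OF _ v] linear_betweenD(3)[OF P_lin w(1)]
        by (auto simp: scaleC_fun_apply scaleC_complex_def intro!: exI[of _ c])
    qed
    \<comment> \<open>Proportionality in cross-multiplied form is a relation with these
      coefficients. By \<open>indep\<close> both vanish, so the functionals vanish at
      \<open>w\<close> and hence everywhere.\<close>
    have "P 1 w \<one>\<^bsub>GL2\<^esub> = 0 \<and> - P 0 w \<one>\<^bsub>GL2\<^esub> = 0"
    proof (rule indep)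
      fix v assume "v \<in> ?V"
      then obtain c where c: "\<And>i. i < m \<Longrightarrow> of_nat CARD('a) * P i v \<one>\<^bsub>GL2\<^esub> = c * P i w \<one>\<^bsub>GL2\<^esub>"
        using line by blast
      have "of_nat CARD('a) * (P 1 w \<one>\<^bsub>GL2\<^esub> * P 0 v \<one>\<^bsub>GL2\<^esub> + - P 0 w \<one>\<^bsub>GL2\<^esub> * P 1 v \<one>\<^bsub>GL2\<^esub>) =
        P 1 w \<one>\<^bsub>GL2\<^esub> * (of_nat CARD('a) * P 0 v \<one>\<^bsub>GL2\<^esub>) -
        P 0 w \<one>\<^bsub>GL2\<^esub> * (of_nat CARD('a) * P 1 v \<one>\<^bsub>GL2\<^esub>)"
        by (simp add: algebra_simps)
      also have "\<dots> = 0"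
        unfolding c[OF m(1)] c[OF m(2)] by simp
      finally show "P 1 w \<one>\<^bsub>GL2\<^esub> * P 0 v \<one>\<^bsub>GL2\<^esub> + - P 0 w \<one>\<^bsub>GL2\<^esub> * P 1 v \<one>\<^bsub>GL2\<^esub> = 0"
        by simp
    qed
    then have "P 0 v \<one>\<^bsub>GL2\<^esub> = 0" if "v \<in> ?V" for v
      using line[OF that] m by auto
    then show False
      using indep[of 1 0] by simp
  qed
qed

section \<open>Commutation forced by multiplicity one\<close>

lemma linear_between_comp:
  assumes "linear_between V W S" "linear_between W X T"
  shows "linear_between V X (\<lambda>v. T (S v))"
  using assms unfolding linear_between_def by (auto simp: Pi_iff)

lemma linear_between_inv_into:
  assumes "linear_between S W J" "complex_vector.subspace S" "inj_on J S"
  shows "linear_between (J ` S) S (inv_into S J)"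
  unfolding linear_between_def
  using assms(3)
  by (auto simp: linear_betweenD(2,3)[OF assms(1), symmetric] inv_into_f_f
      complex_vector.subspace_add[OF assms(2)] complex_vector.subspace_scale[OF assms(2)])

lemma subspace_linear_image:
  assumes "linear_between S W J" "complex_vector.subspace S"
  shows "complex_vector.subspace (J ` S)"
  by (rule complex_vector.subspaceI)
    (auto simp: linear_betweenD(2,3)[OF assms(1), symmetric] complex_vector.subspace_add[OF assms(2)]
      complex_vector.subspace_scale[OF assms(2)] linear_between_0[OF assms]
      intro: rev_image_eqI[OF complex_vector.subspace_0[OF assms(2)]])

text \<open>\<open>multiplicity_free\<close> tests only representations on spaces of sequences, so
  an irreducible space of functions on the group has to be moved there first.\<close>

definition transport_rep :: "('v \<Rightarrow> 'w) \<Rightarrow> ('g, 'v) rep \<Rightarrow> ('g, 'w) rep" where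
  "transport_rep J \<rho> = \<lparr>rep_space = J ` rep_space \<rho>,
     rep_act = (\<lambda>g w. J (rep_act \<rho> g (inv_into (rep_space \<rho>) J w)))\<rparr>"

lemma irreducible_transport_rep:
  assumes "monoid G" "irreducible_rep G \<rho>" "linear_between (rep_space \<rho>) W J" "inj_on J (rep_space \<rho>)"
  shows "irreducible_rep G (transport_rep J \<rho>)"
proof -
  let ?S = "rep_space \<rho>"
  interpret monoid G by fact
  have rep: "group_rep G \<rho>" and nz: "?S \<noteq> {0}"
    using assms(2) by (auto simp: irreducible_rep_def)
  note r = group_repD[OF rep]
  note J = linear_betweenD[OF assms(3)]
  have J0: "J 0 = 0"
    by (rule linear_between_0[OF assms(3) r(1)])
  note zero = complex_vector.subspace_0[OF r(1)]
  have J_img: "linear_between ?S (J ` ?S) J"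
    by (rule linear_between_subset[OF assms(3)]) auto
  have "linear_between (J ` ?S) (J ` ?S) (\<lambda>w. J (rep_act \<rho> g (inv_into ?S J w)))"
    if "g \<in> carrier G" for g
    using linear_between_comp[OF linear_between_comp[OF
          linear_between_inv_into[OF assms(3) r(1) assms(4)] r(2)[OF that]] J_img] .
  then have "group_rep G (transport_rep J \<rho>)"
    unfolding group_rep_def transport_rep_def
    using subspace_linear_image[OF assms(3) r(1)] assms(4)
    by (auto simp: r(3,4,5) inv_into_f_f)
  moreover have "J ` ?S \<noteq> {0}"
  proof -
    obtain v where "v \<in> ?S" "v \<noteq> 0"
      using nz zero by blast
    with assms(4) J0 zero show ?thesis
      by (metis imageI inj_onD singletonD)
  qed
  moreover have "X = {0} \<or> X = J ` ?S" if X: "invariant_subspace G (transport_rep J \<rho>) X" for X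
  proof -
    note X = invariant_subspaceD[OF X]
    have X_sub: "X \<subseteq> J ` ?S"
      using X(2) by (simp add: transport_rep_def)
    have X_act: "J (rep_act \<rho> g v) \<in> X" if "g \<in> carrier G" "v \<in> ?S" "J v \<in> X" for g v
      using X(3)[OF that(1,3)] that(2) assms(4) by (simp add: transport_rep_def)
    define Y where "Y = {v \<in> ?S. J v \<in> X}"
    have "invariant_subspace G \<rho> Y"
      unfolding invariant_subspace_def
      by (auto intro!: complex_vector.subspaceI X_act r(5) simp: Y_def J J0 zero
          complex_vector.subspace_0[OF X(1)] complex_vector.subspace_add[OF X(1)]
          complex_vector.subspace_scale[OF X(1)] complex_vector.subspace_add[OF r(1)]
          complex_vector.subspace_scale[OF r(1)])
    then have "Y = {0} \<or> Y = ?S"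
      using assms(2) by (auto simp: irreducible_rep_def)
    moreover have "X = J ` Y"
      using X_sub by (auto simp: Y_def)
    ultimately show ?thesis
      using J0 by auto
  qed
  ultimately show ?thesis
    unfolding irreducible_rep_def by (simp add: transport_rep_def)
qed

text \<open>An enumeration of the finite index type turns functions into sequences, padded with
  \<open>0\<close>.\<close>

lemma ex_linear_embedding_seq:
  "\<exists>J :: ('x::finite \<Rightarrow> complex) \<Rightarrow> nat \<Rightarrow> complex. linear_between UNIV UNIV J \<and> inj J"
proof -
  let ?e = "to_nat_on (UNIV :: 'x set)"
  let ?J = "\<lambda>(f :: 'x \<Rightarrow> complex) n. if n \<in> range ?e then f (from_nat_into UNIV n) else 0"
  have e: "from_nat_into UNIV (?e x) = x" for x
    by (simp add: countable_finite)
  have "linear_between UNIV UNIV ?J"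
    by (auto simp: linear_between_def fun_eq_iff scaleC_fun_apply)
  moreover have "inj ?J"
  proof (rule injI, rule ext)
    fix f g x assume "?J f = ?J g"
    then have "?J f (?e x) = ?J g (?e x)" by (rule fun_cong)
    then show "f x = g x" by (simp add: e)
  qed
  ultimately show ?thesis by blast
qed

lemma finite_dim_fun:
  "\<exists>B. finite B \<and> (UNIV :: ('x::finite \<Rightarrow> complex) set) \<subseteq> complex_vector.span B"
proof (intro exI conjI subsetI)
  let ?e = "\<lambda>x y :: 'x. if y = x then 1 else (0 :: complex)"
  show "finite (range ?e)" by simp
  fix f :: "'x \<Rightarrow> complex"
  have "f = (\<Sum>x\<in>UNIV. f x *\<^sub>C ?e x)"
    by (auto simp: fun_eq_iff sum_fun_apply scaleC_fun_apply scaleC_complex_def if_distrib cong: if_cong)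
  also have "\<dots> \<in> complex_vector.span (range ?e)"
    by (intro complex_vector.span_sum complex_vector.span_scale complex_vector.span_base) auto
  finally show "f \<in> complex_vector.span (range ?e)" .
qed

text \<open>Otherwise \<open>S\<close> and \<open>\<phi> ` S\<close> would intersect trivially and span two copies of \<open>S\<close>.\<close>

lemma multiplicity_free_image_subset:
  fixes \<rho> :: "('g, 'x::finite \<Rightarrow> complex) rep"
  assumes "monoid G" "group_rep G \<rho>" "multiplicity_free G \<rho>" "intertwiner G \<rho> \<rho> \<phi>"
    and "invariant_subspace G \<rho> S" "irreducible_rep G (\<rho>\<lparr>rep_space := S\<rparr>)"
  shows "\<phi> ` S \<subseteq> S"
proof (rule ccontr)
  assume not_sub: "\<not> \<phi> ` S \<subseteq> S"
  note r = group_repD[OF assms(2)]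
  note S = invariant_subspaceD[OF assms(5)]
  have \<phi>_lin: "linear_between (rep_space \<rho>) (rep_space \<rho>) \<phi>"
    and \<phi>_act: "\<And>g v. g \<in> carrier G \<Longrightarrow> v \<in> rep_space \<rho> \<Longrightarrow>
      \<phi> (rep_act \<rho> g v) = rep_act \<rho> g (\<phi> v)"
    using assms(4) by (auto simp: intertwiner_def)
  note \<phi> = linear_betweenD[OF \<phi>_lin]
  \<comment> \<open>The vectors of \<open>S\<close> that \<open>\<phi>\<close> keeps in
    \<open>S\<close> form an invariant subspace, which is proper by assumption and thus
    zero.\<close>
  have \<phi>_zero: "v = 0" if "v \<in> S" "\<phi> v \<in> S" for v
  proof (rule ccontr)
    assume "v \<noteq> 0"
    define Y where "Y = {v \<in> S. \<phi> v \<in> S}"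
    have "Y = rep_space (\<rho>\<lparr>rep_space := S\<rparr>)"
    proof (rule irreducible_rep_eqI[OF assms(6)])
      show "complex_vector.subspace Y"
        using S(2) by (intro complex_vector.subspaceI)
          (auto simp: Y_def \<phi> subset_iff linear_between_0[OF \<phi>_lin r(1)]
            complex_vector.subspace_0[OF S(1)] complex_vector.subspace_add[OF S(1)]
            complex_vector.subspace_scale[OF S(1)])
      show "v \<in> Y" using that by (simp add: Y_def)
    qed (use S \<phi>_act \<open>v \<noteq> 0\<close> in \<open>auto simp: Y_def subset_iff\<close>)
    then have "\<phi> ` S \<subseteq> S"
      by (auto simp: Y_def)
    with not_sub show False ..
  qed
  obtain J :: "('x \<Rightarrow> complex) \<Rightarrow> nat \<Rightarrow> complex" where J: "linear_between UNIV UNIV J" "inj J"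
    using ex_linear_embedding_seq by blast
  have J_S: "linear_between S UNIV J" "inj_on J S"
    using J by (auto simp: linear_between_def intro: inj_on_subset)
  define \<sigma> where "\<sigma> = transport_rep J (\<rho>\<lparr>rep_space := S\<rparr>)"
  have irr: "irreducible_rep G \<sigma>"
    unfolding \<sigma>_def using irreducible_transport_rep[OF assms(1,6), of UNIV J] J_S by simp
  define I where "I = inv_into S J"
  have I_lin: "linear_between (J ` S) S I"
    unfolding I_def by (rule linear_between_inv_into[OF J_S(1) S(1) J_S(2)])
  note I = linear_betweenD[OF I_lin]
  have \<sigma>: "rep_space \<sigma> = J ` S" "rep_act \<sigma> g w = J (rep_act \<rho> g (I w))" for g w
    by (simp_all add: \<sigma>_def transport_rep_def I_def)
  have IJ: "I (J v) = v" if "v \<in> S" for v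
    using J_S(2) that by (simp add: I_def)
  define T where "T f = I (f 0) + \<phi> (I (f 1))" for f :: "nat \<Rightarrow> nat \<Rightarrow> complex"
  let ?C = "rep_copies 2 \<sigma>"
  have C: "f \<in> rep_space ?C \<longleftrightarrow> f 0 \<in> J ` S \<and> f 1 \<in> J ` S \<and> (\<forall>i\<ge>2. f i = 0)" for f
    by (auto simp: rep_copies_def \<sigma> less_2_cases_iff)
  have I_mem: "I (f 0) \<in> S" "I (f 1) \<in> S" "I (f 0) \<in> rep_space \<rho>" "I (f 1) \<in> rep_space \<rho>"
    if "f \<in> rep_space ?C" for f
    using that I(1) S(2) by (auto simp: C)
  have T_lin: "linear_between (rep_space ?C) (rep_space \<rho>) T"
    unfolding linear_between_def
  proof (intro conjI allI ballI Pi_I)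
    fix f assume f: "f \<in> rep_space ?C"
    show "T f \<in> rep_space \<rho>"
      unfolding T_def using I_mem[OF f] \<phi>(1) by (intro complex_vector.subspace_add[OF r(1)])
    show "T (c *\<^sub>C f) = c *\<^sub>C T f" for c
      using f I_mem[OF f]
      by (simp add: T_def scaleC_fun_apply[of c f] C I(3) \<phi>(3)
          complex_vector.scale_right_distrib)
    fix f' assume f': "f' \<in> rep_space ?C"
    show "T (f + f') = T f + T f'"
      using f f' I_mem[OF f] I_mem[OF f'] by (simp add: T_def C I(2) \<phi>(2))
  qed
  moreover have "T (rep_act ?C g f) = rep_act \<rho> g (T f)"
    if g: "g \<in> carrier G" and f: "f \<in> rep_space ?C" for g f
    using I_mem[OF f] \<phi>(1) S(3)[OF g]
    by (simp add: T_def rep_copies_def \<sigma> IJ linear_betweenD(2)[OF r(2)[OF g]] \<phi>_act[OF g])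
  ultimately have "intertwiner G ?C \<rho> T"
    by (simp add: intertwiner_def)
  moreover have "inj_on T (rep_space ?C)"
  proof (rule inj_onI)
    fix f f' assume f: "f \<in> rep_space ?C" and f': "f' \<in> rep_space ?C" and eq: "T f = T f'"
    have diff: "\<phi> (x - y) = \<phi> x - \<phi> y" if "x \<in> rep_space \<rho>" "y \<in> rep_space \<rho>" for x y
      using \<phi>(2)[of "x - y" y] that by (simp add: complex_vector.subspace_diff[OF r(1)])
    \<comment> \<open>If two pairs have the same image, then \<open>\<phi>\<close> sends the
      difference of their second components to a difference of elements of \<open>S\<close>, so
      \<open>\<phi>_zero\<close> applies.\<close>
    have "I (f 1) - I (f' 1) = 0"
    proof (rule \<phi>_zero)
      show "I (f 1) - I (f' 1) \<in> S"
        using I_mem[OF f] I_mem[OF f'] by (intro complex_vector.subspace_diff[OF S(1)])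
      have "\<phi> (I (f 1) - I (f' 1)) = I (f' 0) - I (f 0)"
        using eq I_mem[OF f] I_mem[OF f'] by (simp add: diff T_def algebra_simps)
      also have "\<dots> \<in> S"
        using I_mem[OF f] I_mem[OF f'] by (intro complex_vector.subspace_diff[OF S(1)])
      finally show "\<phi> (I (f 1) - I (f' 1)) \<in> S" .
    qed
    moreover from this eq have "I (f 0) = I (f' 0)"
      by (simp add: T_def)
    ultimately have "f 0 = f' 0" "f 1 = f' 1"
      using f f' by (auto simp: C IJ)
    moreover have "f i = f' i" if "i \<ge> 2" for i
      using f f' that by (simp add: C)
    ultimately show "f = f'"
      by (metis One_nat_def ext less_2_cases not_le)
  qed
  ultimately have "contains_rep G \<rho> ?C"
    by (auto simp: contains_rep_def)
  then have "(2 :: nat) \<le> 1"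
    using assms(3) irr unfolding multiplicity_free_def by blast
  then show False by simp
qed

text \<open>\<open>\<phi>\<close> preserves \<open>S\<close> and so restricts to an endomorphism of
  an irreducible representation, to which Schur's lemma applies.\<close>

lemma multiplicity_free_scalar:
  fixes \<rho> :: "('g, 'x::finite \<Rightarrow> complex) rep"
  assumes "monoid G" "group_rep G \<rho>" "multiplicity_free G \<rho>" "intertwiner G \<rho> \<rho> \<phi>"
    and "invariant_subspace G \<rho> S" "irreducible_rep G (\<rho>\<lparr>rep_space := S\<rparr>)"
  shows "\<exists>c. \<forall>v\<in>S. \<phi> v = c *\<^sub>C v"
proof -
  note S = invariant_subspaceD(2)[OF assms(5)]
  have image: "\<phi> ` S \<subseteq> S"
    by (rule multiplicity_free_image_subset[OF assms])
  have "linear_between (rep_space \<rho>) (rep_space \<rho>) \<phi>"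
    using assms(4) unfolding intertwiner_def by blast
  then have "linear_between S S \<phi>"
    by (rule linear_between_subset) (use S image in blast)+
  moreover have "\<phi> (rep_act \<rho> g v) = rep_act \<rho> g (\<phi> v)" if "g \<in> carrier G" "v \<in> S" for g v
    using assms(4) S that unfolding intertwiner_def by blast
  ultimately have "intertwiner G (\<rho>\<lparr>rep_space := S\<rparr>) (\<rho>\<lparr>rep_space := S\<rparr>) \<phi>"
    by (simp add: intertwiner_def)
  moreover obtain B where "finite B" "S \<subseteq> complex_vector.span B"
    using finite_dim_fun by blast
  ultimately show ?thesis
    using schur_scalar[OF assms(6), of \<phi> B] by simp
qed

section \<open>The trivial character\<close>

lemma intertwinerD:
  assumes "intertwiner G \<rho> \<sigma> T"
  shows "linear_between (rep_space \<rho>) (rep_space \<sigma>) T"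
    and "v \<in> rep_space \<rho> \<Longrightarrow> T v \<in> rep_space \<sigma>"
    and "g \<in> carrier G \<Longrightarrow> v \<in> rep_space \<rho> \<Longrightarrow> T (rep_act \<rho> g v) = rep_act \<sigma> g (T v)"
  using assms by (auto simp: intertwiner_def linear_between_def)

lemma intertwiner_comp:
  assumes "intertwiner G \<rho> \<sigma> S" "intertwiner G \<sigma> \<tau> T"
  shows "intertwiner G \<rho> \<tau> (\<lambda>v. T (S v))"
  using assms linear_between_comp[of "rep_space \<rho>" "rep_space \<sigma>" S "rep_space \<tau>" T]
  by (auto simp: intertwiner_def linear_betweenD(1))

lemma intertwiner_diff:
  assumes "group_rep G \<sigma>" "intertwiner G \<rho> \<sigma> S" "intertwiner G \<rho> \<sigma> T"
  shows "intertwiner G \<rho> \<sigma> (\<lambda>v. S v - T v)"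
proof -
  note r = group_repD[OF assms(1)]
  note S = intertwinerD[OF assms(2)] and T = intertwinerD[OF assms(3)]
  have "rep_act \<sigma> g (v - w) = rep_act \<sigma> g v - rep_act \<sigma> g w"
    if "g \<in> carrier G" "v \<in> rep_space \<sigma>" "w \<in> rep_space \<sigma>" for g v w
    using linear_betweenD(2)[OF r(2)[OF that(1)], of "v - w" w] that
    by (simp add: complex_vector.subspace_diff[OF r(1)])
  then show ?thesis
    using S T unfolding intertwiner_def linear_between_def
    by (auto simp: complex_vector.subspace_diff[OF r(1)] complex_vector.scale_right_diff_distrib)
qed

lemma invariant_subspace_image:
  assumes "group_rep G \<rho>" "intertwiner G \<rho> \<sigma> T"
  shows "invariant_subspace G \<sigma> (T ` rep_space \<rho>)"
  unfolding invariant_subspace_def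
  using subspace_linear_image[OF intertwinerD(1)[OF assms(2)] group_repD(1)[OF assms(1)]]
    intertwinerD(2)[OF assms(2)] intertwinerD(3)[OF assms(2), symmetric] group_repD(5)[OF assms(1)]
  by auto

section \<open>Torus and Weyl element\<close>

definition diag2 :: "'a::field \<Rightarrow> 'a \<Rightarrow> 'a ^ 2 ^ 2" where
  "diag2 a d = vector [vector [a, 0], vector [0, d]]"

definition weyl :: "'a::field ^ 2 ^ 2" where
  "weyl = vector [vector [0, 1], vector [1, 0]]"

lemmas matrix2_simps = vec_eq_iff forall_2 matrix_matrix_mult_def sum_2 mat_def

lemma weyl_weyl: "weyl ** weyl = mat 1"
  by (simp add: weyl_def matrix2_simps)

lemma diag2_mult: "diag2 a b ** diag2 c d = diag2 (a * c) (b * d)"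
  by (simp add: diag2_def matrix2_simps)

lemma diag2_1: "diag2 1 1 = mat 1"
  by (simp add: diag2_def matrix2_simps)

lemma diag2_in_GL2: "a \<noteq> 0 \<Longrightarrow> d \<noteq> 0 \<Longrightarrow> diag2 a d \<in> carrier GL2"
  by (simp add: carrier_GL2_iff diag2_def)

lemma weyl_in_GL2: "weyl \<in> carrier GL2"
  by (simp add: carrier_GL2_iff weyl_def)

text \<open>This and the next two rules carry a left factor \<open>A\<close> so that they rewrite
  inside left-nested products.\<close>

lemma mult_unipotent_unipotent: "A ** unipotent b ** unipotent c = A ** unipotent (b + c)"
  by (simp add: matrix_mul_assoc[symmetric] unipotent_mult)

lemma mult_unipotent_diag2:
  assumes "a \<noteq> 0"
  shows "A ** unipotent b ** diag2 a d = A ** diag2 a d ** unipotent (b * d / a)"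
proof -
  have "unipotent b ** diag2 a d = diag2 a d ** unipotent (b * d / a)"
    using assms by (simp add: unipotent_def diag2_def matrix2_simps)
  then show ?thesis
    by (simp add: matrix_mul_assoc[symmetric])
qed

lemma mult_weyl_diag2: "A ** weyl ** diag2 a d = A ** diag2 d a ** weyl"
proof -
  have "weyl ** diag2 a d = diag2 d a ** weyl"
    by (simp add: weyl_def diag2_def matrix2_simps)
  then show ?thesis
    by (simp add: matrix_mul_assoc[symmetric])
qed

section \<open>Functions on the quotient by \<open>U\<close> and their endomorphisms\<close>

lemma mem_U_iff: "x \<in> U \<longleftrightarrow> x $ 1 $ 1 = 1 \<and> x $ 2 $ 1 = 0 \<and> x $ 2 $ 2 = 1"
  by (auto simp: U_def unipotent_def vec_eq_iff forall_2)

lemma mult_in_GL2_iff: "B \<in> carrier GL2 \<Longrightarrow> A ** B \<in> carrier GL2 \<longleftrightarrow> A \<in> carrier GL2"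
  by (simp add: GL2_def invertible_det_nz det_mul)

abbreviation U_invariants ::
    "('a::{field, finite} ^ 2 ^ 2, 'a ^ 2 ^ 2 \<Rightarrow> complex) rep" where
  "U_invariants \<equiv> induced_rep GL2 U trivial_rep"

text \<open>\<open>x ** unipotent b\<close> is invertible exactly when \<open>x\<close> is, so both
  values are \<open>0\<close> outside \<open>GL2\<close>. Invariance then holds for all matrices,
  and sums may run over the whole type.\<close>

lemma U_invariants_iff:
  "f \<in> rep_space U_invariants \<longleftrightarrow>
    (\<forall>x. x \<notin> carrier GL2 \<longrightarrow> f x = 0) \<and> (\<forall>x b. f (x ** unipotent b) = f x)" (is "?L \<longleftrightarrow> ?R")
proof
  assume L: ?L
  have "f (x ** unipotent b) = f x" for x b
    using L by (cases "x \<in> carrier GL2")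
      (auto simp: induced_rep_def trivial_rep_def mult_GL2 U_def mult_in_GL2_iff unipotent_in_GL2)
  with L show ?R
    by (auto simp: induced_rep_def)
qed (auto simp: induced_rep_def trivial_rep_def mult_GL2 U_def)

lemma group_rep_U_invariants: "group_rep GL2 (U_invariants :: ('a::{field, finite} ^ 2 ^ 2, _) rep)"
proof (rule group_rep_induced_rep[OF group_GL2 subgroup_U])
  show "group_rep (GL2\<lparr>carrier := U\<rparr>) (trivial_rep :: ('a ^ 2 ^ 2, complex) rep)"
    by (auto simp: group_rep_def linear_between_def trivial_rep_def)
qed

definition translate_sum ::
    "('i::finite \<Rightarrow> 'a::field ^ 2 ^ 2) \<Rightarrow> ('a ^ 2 ^ 2 \<Rightarrow> complex) \<Rightarrow> 'a ^ 2 ^ 2 \<Rightarrow> complex" where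
  "translate_sum t f x = (\<Sum>i\<in>UNIV. f (x ** t i))"

text \<open>Right translations commute with the left action, and invertible \<open>t i\<close> keep
  the support inside \<open>GL2\<close>; only the invariance under \<open>U\<close> depends on the
  particular sum.\<close>

lemma intertwiner_translate_sum:
  assumes t: "\<And>i. t i \<in> carrier GL2"
    and inv: "\<And>f x b. f \<in> rep_space U_invariants \<Longrightarrow>
      translate_sum t f (x ** unipotent b) = translate_sum t f x"
  shows "intertwiner GL2 U_invariants (U_invariants :: ('a::{field, finite} ^ 2 ^ 2, _) rep) (translate_sum t)"
proof -
  interpret group "GL2 :: ('a ^ 2 ^ 2) monoid" by (rule group_GL2)
  show ?thesis
    unfolding intertwiner_def linear_between_def
  proof (intro conjI allI ballI Pi_I)
    fix f :: "'a ^ 2 ^ 2 \<Rightarrow> complex" assume f: "f \<in> rep_space U_invariants"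
    with inv show "translate_sum t f \<in> rep_space U_invariants"
      unfolding U_invariants_iff by (auto simp: translate_sum_def mult_in_GL2_iff t)
    show "translate_sum t (c *\<^sub>C f) = c *\<^sub>C translate_sum t f" for c
      by (simp add: translate_sum_def fun_eq_iff scaleC_fun_apply scaleC_complex_def sum_distrib_left)
  next
    fix f g :: "'a ^ 2 ^ 2 \<Rightarrow> complex"
    show "translate_sum t (f + g) = translate_sum t f + translate_sum t g"
      by (simp add: translate_sum_def fun_eq_iff sum.distrib)
  next
    fix h :: "'a ^ 2 ^ 2" and f :: "'a ^ 2 ^ 2 \<Rightarrow> complex"
    show "translate_sum t (rep_act U_invariants h f) = rep_act U_invariants h (translate_sum t f)"
      by (auto simp: translate_sum_def fun_eq_iff induced_rep_def mult_GL2 mult_in_GL2_iff t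
          matrix_mul_assoc)
  qed
qed

text \<open>A sum with one term, indexed by \<open>unit\<close>, so that
  \<open>intertwiner_translate_sum\<close> covers it too.\<close>

abbreviation right_translate ::
    "'a::field ^ 2 ^ 2 \<Rightarrow> ('a ^ 2 ^ 2 \<Rightarrow> complex) \<Rightarrow> 'a ^ 2 ^ 2 \<Rightarrow> complex" where
  "right_translate t \<equiv> translate_sum (\<lambda>_ :: unit. t)"

lemma right_translate_apply: "right_translate t f x = f (x ** t)"
  by (simp add: translate_sum_def)

text \<open>The standard intertwining operator of the principal series, for all characters of the
  torus at once. The sum over \<open>b\<close> restores the invariance that translation by
  \<open>weyl\<close> destroys.\<close>

definition weyl_sum :: "('a::{field, finite} ^ 2 ^ 2 \<Rightarrow> complex) \<Rightarrow> 'a ^ 2 ^ 2 \<Rightarrow> complex" where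
  "weyl_sum = translate_sum (\<lambda>b. unipotent b ** weyl)"

lemma weyl_sum_apply: "weyl_sum f x = (\<Sum>b\<in>UNIV. f (x ** unipotent b ** weyl))"
  by (simp add: weyl_sum_def translate_sum_def matrix_mul_assoc)

text \<open>Diagonal matrices normalise \<open>U\<close>, so translation by them preserves right
  invariance.\<close>

lemma intertwiner_right_translate:
  fixes a d :: "'a::{field, finite}"
  assumes "a \<noteq> 0" "d \<noteq> 0"
  shows "intertwiner GL2 U_invariants U_invariants (right_translate (diag2 a d))"
proof (rule intertwiner_translate_sum)
  fix f :: "'a ^ 2 ^ 2 \<Rightarrow> complex" and x :: "'a ^ 2 ^ 2" and b
  assume f: "f \<in> rep_space U_invariants"
  then show "right_translate (diag2 a d) f (x ** unipotent b) = right_translate (diag2 a d) f x"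
    by (simp add: right_translate_apply U_invariants_iff mult_unipotent_diag2 assms)
qed (simp add: diag2_in_GL2 assms)

lemma intertwiner_weyl_sum:
  "intertwiner GL2 U_invariants (U_invariants :: ('a::{field, finite} ^ 2 ^ 2, _) rep) weyl_sum"
  unfolding weyl_sum_def
proof (rule intertwiner_translate_sum)
  fix f :: "'a ^ 2 ^ 2 \<Rightarrow> complex" and x :: "'a ^ 2 ^ 2" and c
  have "(\<Sum>b\<in>UNIV. f (x ** unipotent (b + c) ** weyl)) = (\<Sum>b\<in>UNIV. f (x ** unipotent b ** weyl))"
    by (rule sum_UNIV_shift)
  then show "translate_sum (\<lambda>b. unipotent b ** weyl) f (x ** unipotent c) =
      translate_sum (\<lambda>b. unipotent b ** weyl) f x"
    by (simp add: translate_sum_def matrix_mul_assoc mult_unipotent_unipotent add.commute)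
qed (simp add: mult_in_GL2 unipotent_in_GL2 weyl_in_GL2)

text \<open>Moved to the left, \<open>diag2 a d\<close> swaps its entries at \<open>weyl\<close> and
  rescales \<open>b\<close> at \<open>unipotent b\<close>; the sum over \<open>b\<close> absorbs the
  rescaling.\<close>

lemma weyl_sum_right_translate:
  assumes "f \<in> rep_space U_invariants" "a \<noteq> 0" "d \<noteq> 0"
  shows "weyl_sum (right_translate (diag2 a d) f) = right_translate (diag2 d a) (weyl_sum f)"
proof
  fix x
  have "weyl_sum (right_translate (diag2 a d) f) x =
      (\<Sum>b\<in>UNIV. f (x ** diag2 d a ** unipotent (b * a / d) ** weyl))"
    using assms(3)
    by (simp add: weyl_sum_apply right_translate_apply mult_weyl_diag2 mult_unipotent_diag2)
  also have "\<dots> = (\<Sum>b\<in>UNIV. f (x ** diag2 d a ** unipotent b ** weyl))"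
    by (rule sum.reindex_bij_witness[of _ "\<lambda>b. b * d / a" "\<lambda>b. b * a / d"]) (use assms in auto)
  finally show "weyl_sum (right_translate (diag2 a d) f) x =
      right_translate (diag2 d a) (weyl_sum f) x"
    by (simp add: weyl_sum_apply right_translate_apply)
qed

section \<open>Adjoints for the Hermitian inner product\<close>

definition inner_prod :: "('x::finite \<Rightarrow> complex) \<Rightarrow> ('x \<Rightarrow> complex) \<Rightarrow> complex" where
  "inner_prod f h = (\<Sum>x\<in>UNIV. f x * cnj (h x))"

lemma inner_prod_diff_left: "inner_prod (f - g) h = inner_prod f h - inner_prod g h"
  by (simp add: inner_prod_def left_diff_distrib sum_subtractf)

lemma inner_prod_self_eq_0:
  assumes "inner_prod f f = 0"
  shows "f = 0"
proof -
  have "complex_of_real (\<Sum>x\<in>UNIV. (cmod (f x))\<^sup>2) = 0"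
    using assms unfolding inner_prod_def of_real_sum complex_norm_square .
  then have "(\<Sum>x\<in>UNIV. (cmod (f x))\<^sup>2) = 0"
    by (simp only: of_real_eq_0_iff)
  then show ?thesis
    by (subst (asm) sum_nonneg_eq_0_iff) (auto simp: fun_eq_iff)
qed

text \<open>Translation by \<open>t\<close> permutes all matrices, with inverse translation by
  \<open>t'\<close>.\<close>

lemma sum_translate_adjoint:
  fixes f h :: "'a::{field, finite} ^ 2 ^ 2 \<Rightarrow> complex"
  assumes "t ** t' = mat 1"
  shows "(\<Sum>x\<in>UNIV. f (x ** t) * cnj (h x)) = (\<Sum>x\<in>UNIV. f x * cnj (h (x ** t')))"
proof -
  have "t' ** t = mat 1"
    using assms matrix_left_right_inverse by blast
  with assms show ?thesis
    by (intro sum.reindex_bij_witness[of _ "\<lambda>x. x ** t'" "\<lambda>x. x ** t"])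
      (auto simp: matrix_mul_assoc[symmetric])
qed

lemma right_translate_adjoint:
  assumes "t ** t' = mat 1"
  shows "inner_prod (right_translate t f) h = inner_prod f (right_translate t' h)"
  using sum_translate_adjoint[OF assms] by (simp add: inner_prod_def right_translate_apply)

text \<open>Both sides equal \<open>?s\<close>: since \<open>weyl\<close> is its own inverse, moving
  translations across the product leaves only \<open>weyl\<close> on \<open>h\<close>, and the
  unipotent factors disappear by the invariance of \<open>h\<close> or \<open>f\<close>.\<close>

lemma weyl_sum_adjoint:
  fixes f h :: "'a::{field, finite} ^ 2 ^ 2 \<Rightarrow> complex"
  assumes f: "f \<in> rep_space U_invariants" and h: "h \<in> rep_space U_invariants"
  shows "inner_prod (weyl_sum f) h = inner_prod f (weyl_sum h)"
proof -
  let ?s = "of_nat CARD('a) * (\<Sum>x\<in>UNIV. f x * cnj (h (x ** weyl)))"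
  have "inner_prod (weyl_sum f) h = (\<Sum>b\<in>UNIV. \<Sum>x\<in>UNIV. f (x ** (unipotent b ** weyl)) * cnj (h x))"
    unfolding inner_prod_def weyl_sum_apply sum_distrib_right
    by (subst sum.swap) (simp add: matrix_mul_assoc)
  also have "\<dots> = (\<Sum>b\<in>UNIV. \<Sum>x\<in>UNIV. f x * cnj (h (x ** (weyl ** unipotent (- b)))))"
  proof (rule sum.cong[OF refl], rule sum_translate_adjoint)
    fix b :: 'a
    have "unipotent b ** weyl ** (weyl ** unipotent (- b)) =
        unipotent b ** (weyl ** weyl) ** unipotent (- b)"
      by (simp only: matrix_mul_assoc)
    then show "unipotent b ** weyl ** (weyl ** unipotent (- b)) = mat 1"
      by (simp add: weyl_weyl unipotent_mult unipotent_0)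
  qed
  also have "\<dots> = ?s"
    using h by (simp add: matrix_mul_assoc U_invariants_iff)
  finally have left: "inner_prod (weyl_sum f) h = ?s" .
  have "inner_prod f (weyl_sum h) = (\<Sum>b\<in>UNIV. \<Sum>x\<in>UNIV. f x * cnj (h (x ** unipotent b ** weyl)))"
    unfolding inner_prod_def weyl_sum_apply cnj_sum sum_distrib_left by (rule sum.swap)
  also have "\<dots> = (\<Sum>b\<in>UNIV. \<Sum>x\<in>UNIV. f (x ** unipotent (- b)) * cnj (h (x ** weyl)))"
    by (rule sum.cong[OF refl], rule sum_translate_adjoint[symmetric, where h = "\<lambda>x. h (x ** weyl)"])
      (simp add: unipotent_mult unipotent_0)
  also have "\<dots> = ?s"
    using f by (simp add: U_invariants_iff)
  finally show ?thesis
    using left by simp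
qed

text \<open>A commutator of two endomorphisms vanishes on every irreducible subspace on which both are
  scalar; a contradiction results from choosing that subspace in the image of the adjoint of the
  commutator.\<close>

lemma not_multiplicity_free_trivial_rep:
  fixes a :: "'a::{field, finite}"
  assumes a: "a \<noteq> 0" "a \<noteq> 1"
  shows "\<not> multiplicity_free (GL2 :: ('a ^ 2 ^ 2) monoid) (induced_rep GL2 U trivial_rep)"
proof
  let ?\<rho> = "U_invariants :: ('a ^ 2 ^ 2, 'a ^ 2 ^ 2 \<Rightarrow> complex) rep"
  let ?R = "\<lambda>a d :: 'a. right_translate (diag2 a d)"
  let ?M = "weyl_sum :: ('a ^ 2 ^ 2 \<Rightarrow> complex) \<Rightarrow> _"
  assume mf: "multiplicity_free GL2 ?\<rho>"
  interpret group "GL2 :: ('a ^ 2 ^ 2) monoid" by (rule group_GL2)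
  note rep = group_rep_U_invariants[where 'a = 'a]
  note M = intertwiner_weyl_sum[where 'a = 'a]
  \<comment> \<open>The adjoint of the commutator of \<open>?M\<close> and \<open>?R a 1\<close>.
    The parameters are inverted because translations by inverse matrices are adjoint.\<close>
  define D where "D f = ?R (1 / a) 1 (?M f) - ?R 1 (1 / a) (?M f)" for f
  have D: "intertwiner GL2 ?\<rho> ?\<rho> D"
    unfolding D_def using a
    by (intro intertwiner_diff[OF rep] intertwiner_comp[OF M] intertwiner_right_translate) auto
  define \<delta> :: "'a ^ 2 ^ 2 \<Rightarrow> complex" where "\<delta> x = (if x \<in> U then 1 else 0)" for x
  have \<delta>: "\<delta> \<in> rep_space ?\<rho>"
    unfolding U_invariants_iff
    by (auto simp: \<delta>_def mem_U_iff carrier_GL2_iff unipotent_def matrix2_simps)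
  \<comment> \<open>\<open>weyl ** unipotent b ** weyl\<close> is lower unitriangular, so it lies in
    \<open>U\<close> only for \<open>b = 0\<close>.\<close>
  have "?M \<delta> weyl = (\<Sum>b\<in>(UNIV :: 'a set). if b = 0 then 1 else 0)"
    unfolding weyl_sum_apply
    by (intro sum.cong refl) (simp add: \<delta>_def mem_U_iff weyl_def unipotent_def matrix2_simps)
  \<comment> \<open>Here the matrices are lower triangular with diagonal \<open>1 / a\<close>,
    \<open>a\<close>, never in \<open>U\<close> because \<open>a\<close> is not
    \<open>1\<close>.\<close>
  moreover have "?M \<delta> (weyl ** diag2 a (1 / a)) = 0"
    unfolding weyl_sum_apply using a
    by (intro sum.neutral ballI)
      (simp add: \<delta>_def mem_U_iff weyl_def diag2_def unipotent_def matrix2_simps)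
  ultimately have "D \<delta> (weyl ** diag2 a 1) = 1"
    using a by (simp add: D_def right_translate_apply matrix_mul_assoc[symmetric] diag2_mult diag2_1)
  then have "D \<delta> \<noteq> 0" by auto
  then have "D ` rep_space ?\<rho> \<noteq> {0}"
    using \<delta> by blast
  moreover obtain B :: "('a ^ 2 ^ 2 \<Rightarrow> complex) set"
    where B: "finite B" "UNIV \<subseteq> complex_vector.span B"
    using finite_dim_fun by blast
  ultimately obtain S where S: "S \<subseteq> D ` rep_space ?\<rho>" "invariant_subspace GL2 ?\<rho> S"
    "irreducible_rep GL2 (?\<rho>\<lparr>rep_space := S\<rparr>)"
    using ex_irreducible_subrep[OF rep invariant_subspace_image[OF rep D] _ B(1)] by blast
  note scalar = multiplicity_free_scalar[OF is_monoid rep mf _ S(2,3)]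
  obtain \<mu> where \<mu>: "\<And>v. v \<in> S \<Longrightarrow> ?M v = \<mu> *\<^sub>C v"
    using scalar[OF M] by blast
  obtain \<nu> where \<nu>: "\<And>v. v \<in> S \<Longrightarrow> ?R a 1 v = \<nu> *\<^sub>C v"
    using scalar[OF intertwiner_right_translate[OF a(1), of 1]] by auto
  have "v = 0" if v: "v \<in> S" for v
  proof -
    obtain h where h: "h \<in> rep_space ?\<rho>" "v = D h"
      using S(1) v by blast
    have v\<rho>: "v \<in> rep_space ?\<rho>"
      using invariant_subspaceD(2)[OF S(2)] v by blast
    have R: "?R c d v \<in> rep_space ?\<rho>" if "c \<noteq> 0" "d \<noteq> 0" for c d
      by (rule intertwinerD(2)[OF intertwiner_right_translate[OF that] v\<rho>])
    have "inner_prod (D h) v = inner_prod (?M h) (?R a 1 v) - inner_prod (?M h) (?R 1 a v)"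
      using a unfolding D_def inner_prod_diff_left
      by (simp add: right_translate_adjoint[of _ "diag2 a 1"] right_translate_adjoint[of _ "diag2 1 a"]
          diag2_mult diag2_1)
    also have "\<dots> = inner_prod h (?M (?R a 1 v)) - inner_prod h (?M (?R 1 a v))"
      using a by (simp add: weyl_sum_adjoint[OF h(1)] R)
    \<comment> \<open>After this rewriting the difference is the commutator applied to
      \<open>v\<close>, which vanishes because both operators are scalar on
      \<open>S\<close>.\<close>
    also have "?M (?R 1 a v) = ?R a 1 (?M v)"
      using a by (simp add: weyl_sum_right_translate v\<rho>)
    also have "\<dots> = ?R a 1 (\<mu> *\<^sub>C v)"
      by (simp add: \<mu> v)
    also have "\<dots> = ?M (?R a 1 v)"
      using invariant_subspaceD(1)[OF S(2)] v
      by (simp add: \<nu> \<mu> complex_vector.subspace_scale complex_vector.scale_left_commute)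
    finally have "inner_prod v v = 0"
      using h(2) by simp
    then show "v = 0"
      by (rule inner_prod_self_eq_0)
  qed
  then have "S \<subseteq> {0}" by blast
  moreover have "S \<noteq> {0}" "0 \<in> S"
    using S(3) complex_vector.subspace_0[OF invariant_subspaceD(1)[OF S(2)]]
    by (auto simp: irreducible_rep_def)
  ultimately show False by blast
qed

theorem theorem8p1:
  fixes p n q :: nat
  assumes "prime p" and "n \<ge> 1" and "q = p ^ n" and "CARD('a::{field, finite}) = q"
  shows "(\<forall>\<psi> :: 'a \<Rightarrow> complex. additive_character \<psi> \<and> \<psi> \<noteq> (\<lambda>_. 1) \<longrightarrow>
            multiplicity_free_triple (GL2 :: ('a ^ 2 ^ 2) monoid) U (char_rep \<psi>)) \<and>
         (q \<noteq> 2 \<longrightarrow>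
            \<not> gelfand_pair (GL2 :: ('a ^ 2 ^ 2) monoid) U \<and>
            \<not> multiplicity_free_triple (GL2 :: ('a ^ 2 ^ 2) monoid) U (char_rep (\<lambda>_. 1)))"
proof -
  have "\<not> gelfand_pair (GL2 :: ('a ^ 2 ^ 2) monoid) U" if "q \<noteq> 2"
  proof -
    \<comment> \<open>A third field element yields the non-scalar matrix \<open>diag2 a 1\<close>,
      whose translation fails to commute with \<open>weyl_sum\<close>.\<close>
    have "\<exists>a :: 'a. a \<noteq> 0 \<and> a \<noteq> 1"
    proof (rule ccontr)
      assume "\<not> ?thesis"
      then have "(UNIV :: 'a set) = {0, 1}" by auto
      then have "CARD('a) = card {0, 1 :: 'a}" by simp
      with assms(4) \<open>q \<noteq> 2\<close> show False by simp
    qed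
    then show ?thesis
      using not_multiplicity_free_trivial_rep
      by (auto simp: gelfand_pair_def multiplicity_free_triple_def)
  qed
  then show ?thesis
    using multiplicity_free_char_rep
    by (auto simp: gelfand_pair_def multiplicity_free_triple_def char_rep_trivial)
qed

end
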